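(* Let $\mathcal{A}$ be an abelian category. (1) Let $M$ and $N_1,\dots,N_n$ be objects of $\mathcal{A}$. Then $\bigoplus_{i=1}^n N_i$ is $M$-CS-Rickart if and only if $N_i$ is $M$-CS-Rickart for every $i\in\{1,\dots,n\}$. (2) Let $M_1,\dots,M_n$ and $N$ be objects of $\mathcal{A}$. Then $N$ is dual $\bigoplus_{i=1}^n M_i$-CS-Rickart if and only if $N$ is dual $M_i$-CS-Rickart for every $i\in\{1,\dots,n\}$.
   Context: A subobject $K$ of $L$ is essential in $L$ if $K\cap X=0$ implies $X=0$ for every subobject $X$ of $L$; $K$ is superfluous in $L$ if $K+X=L$ implies $X=L$ for every subobject $X$ of $L$. A subobject $L$ of $M$ lies above a direct summand of $M$ if $L$ contains a direct summand $K$ of $M$ such that $L/K$ is superfluous in $M/K$. For objects $M,N$ of an abelian category: $N$ is $M$-CS-Rickart if for every morphism $f:M\to N$, $\mathrm{Ker}(f)$ is essential in a direct summand of $M$; $N$ is dual $M$-CS-Rickart if for every morphism $f:M\to N$, $\mathrm{Im}(f)$ lies above a direct summand of $N$. *)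

theory Defs
  imports "HOL-Algebra.Algebra"
begin

section \<open>Abelian categories\<close>

record ('o, 'm) cat =
  Obj :: "'o set"
  Arr :: "'m set"
  Dom :: "'m \<Rightarrow> 'o"
  Cod :: "'m \<Rightarrow> 'o"
  Ident :: "'o \<Rightarrow> 'm"
  Comp :: "'m \<Rightarrow> 'm \<Rightarrow> 'm" (infixr "\<cdot>\<index>" 70)

text \<open>\<open>g \<cdot> f\<close> is ``first \<open>f\<close>, then \<open>g\<close>''; it is only meaningful when \<open>Cod f = Dom g\<close>.\<close>

record ('o, 'm) preadditive_cat = "('o, 'm) cat" +
  Plus :: "'m \<Rightarrow> 'm \<Rightarrow> 'm"
  Zero :: "'o \<Rightarrow> 'o \<Rightarrow> 'm"

definition Hom :: "('o, 'm, 'x) cat_scheme \<Rightarrow> 'o \<Rightarrow> 'o \<Rightarrow> 'm set" where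
  "Hom C a b = {f \<in> Arr C. Dom C f = a \<and> Cod C f = b}"

text \<open>The hom-groups are written additively here, but are stored in the multiplicative group
  record of the library, so that a finite sum of parallel morphisms is a \<^const>\<open>finprod\<close>.\<close>

definition Hom_group :: "('o, 'm, 'x) preadditive_cat_scheme \<Rightarrow> 'o \<Rightarrow> 'o \<Rightarrow> 'm monoid" where
  "Hom_group C a b = \<lparr>carrier = Hom C a b, monoid.mult = Plus C, one = Zero C a b\<rparr>"

locale category =
  fixes C :: "('o, 'm, 'x) cat_scheme" (structure)
  assumes Dom_Obj: "f \<in> Arr C \<Longrightarrow> Dom C f \<in> Obj C"
    and Cod_Obj: "f \<in> Arr C \<Longrightarrow> Cod C f \<in> Obj C"
    and Ident_Hom: "a \<in> Obj C \<Longrightarrow> Ident C a \<in> Hom C a a"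
    and Comp_Hom: "f \<in> Hom C a b \<Longrightarrow> g \<in> Hom C b c \<Longrightarrow> g \<cdot> f \<in> Hom C a c"
    and Comp_Ident: "f \<in> Hom C a b \<Longrightarrow> f \<cdot> Ident C a = f"
    and Ident_Comp: "f \<in> Hom C a b \<Longrightarrow> Ident C b \<cdot> f = f"
    and Comp_assoc: "f \<in> Hom C a b \<Longrightarrow> g \<in> Hom C b c \<Longrightarrow> h \<in> Hom C c d \<Longrightarrow>
      (h \<cdot> g) \<cdot> f = h \<cdot> (g \<cdot> f)"

locale preadditive_category = category C
  for C :: "('o, 'm, 'x) preadditive_cat_scheme" (structure) +
  assumes Hom_comm_group: "a \<in> Obj C \<Longrightarrow> b \<in> Obj C \<Longrightarrow> comm_group (Hom_group C a b)"
    and Comp_Plus: "f \<in> Hom C a b \<Longrightarrow> f' \<in> Hom C a b \<Longrightarrow> g \<in> Hom C b c \<Longrightarrow>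
      g \<cdot> Plus C f f' = Plus C (g \<cdot> f) (g \<cdot> f')"
    and Plus_Comp: "f \<in> Hom C a b \<Longrightarrow> g \<in> Hom C b c \<Longrightarrow> g' \<in> Hom C b c \<Longrightarrow>
      Plus C g g' \<cdot> f = Plus C (g \<cdot> f) (g' \<cdot> f)"

definition is_mono :: "('o, 'm, 'x) cat_scheme \<Rightarrow> 'm \<Rightarrow> bool" where
  "is_mono C f \<longleftrightarrow> f \<in> Arr C \<and>
    (\<forall>a. \<forall>g \<in> Hom C a (Dom C f). \<forall>h \<in> Hom C a (Dom C f).
      f \<cdot>\<^bsub>C\<^esub> g = f \<cdot>\<^bsub>C\<^esub> h \<longrightarrow> g = h)"

definition is_epi :: "('o, 'm, 'x) cat_scheme \<Rightarrow> 'm \<Rightarrow> bool" where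
  "is_epi C f \<longleftrightarrow> f \<in> Arr C \<and>
    (\<forall>b. \<forall>g \<in> Hom C (Cod C f) b. \<forall>h \<in> Hom C (Cod C f) b.
      g \<cdot>\<^bsub>C\<^esub> f = h \<cdot>\<^bsub>C\<^esub> f \<longrightarrow> g = h)"

definition is_kernel :: "('o, 'm, 'x) preadditive_cat_scheme \<Rightarrow> 'm \<Rightarrow> 'm \<Rightarrow> bool" where
  "is_kernel C f k \<longleftrightarrow> f \<in> Arr C \<and> k \<in> Arr C \<and> Cod C k = Dom C f \<and>
    f \<cdot>\<^bsub>C\<^esub> k = Zero C (Dom C k) (Cod C f) \<and>
    (\<forall>a. \<forall>g \<in> Hom C a (Dom C f). f \<cdot>\<^bsub>C\<^esub> g = Zero C a (Cod C f) \<longrightarrow>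
      (\<exists>!u. u \<in> Hom C a (Dom C k) \<and> k \<cdot>\<^bsub>C\<^esub> u = g))"

definition is_cokernel :: "('o, 'm, 'x) preadditive_cat_scheme \<Rightarrow> 'm \<Rightarrow> 'm \<Rightarrow> bool" where
  "is_cokernel C f q \<longleftrightarrow> f \<in> Arr C \<and> q \<in> Arr C \<and> Dom C q = Cod C f \<and>
    q \<cdot>\<^bsub>C\<^esub> f = Zero C (Dom C f) (Cod C q) \<and>
    (\<forall>b. \<forall>g \<in> Hom C (Cod C f) b. g \<cdot>\<^bsub>C\<^esub> f = Zero C (Dom C f) b \<longrightarrow>
      (\<exists>!u. u \<in> Hom C (Cod C q) b \<and> u \<cdot>\<^bsub>C\<^esub> q = g))"

text \<open>\<open>S\<close>, with injections \<open>\<iota> i\<close> and projections \<open>\<pi> i\<close>, is a direct sum (biproduct) of the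
  finite family \<open>(N i)\<close>, \<open>i \<in> I\<close>.  Direct sums are determined only up to isomorphism, so this is
  a predicate rather than an operation.\<close>

definition is_direct_sum ::
  "('o, 'm, 'x) preadditive_cat_scheme \<Rightarrow> 'i set \<Rightarrow> ('i \<Rightarrow> 'o) \<Rightarrow> 'o \<Rightarrow>
    ('i \<Rightarrow> 'm) \<Rightarrow> ('i \<Rightarrow> 'm) \<Rightarrow> bool" where
  "is_direct_sum C I N S \<iota> \<pi> \<longleftrightarrow> finite I \<and> S \<in> Obj C \<and>
    (\<forall>i\<in>I. N i \<in> Obj C \<and> \<iota> i \<in> Hom C (N i) S \<and> \<pi> i \<in> Hom C S (N i)) \<and>
    (\<forall>i\<in>I. \<forall>j\<in>I. \<pi> i \<cdot>\<^bsub>C\<^esub> \<iota> j = (if i = j then Ident C (N i) else Zero C (N j) (N i))) \<and>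
    finprod (Hom_group C S S) (\<lambda>i. \<iota> i \<cdot>\<^bsub>C\<^esub> \<pi> i) I = Ident C S"

text \<open>The case \<open>n = 0\<close> of the first assumption provides a zero object.\<close>

locale abelian_category = preadditive_category C
  for C :: "('o, 'm, 'x) preadditive_cat_scheme" (structure) +
  assumes ex_direct_sum: "(\<And>i. i \<in> {1..n::nat} \<Longrightarrow> N i \<in> Obj C) \<Longrightarrow>
      \<exists>S \<iota> \<pi>. is_direct_sum C {1..n} N S \<iota> \<pi>"
    and ex_kernel: "f \<in> Arr C \<Longrightarrow> \<exists>k. is_kernel C f k"
    and ex_cokernel: "f \<in> Arr C \<Longrightarrow> \<exists>q. is_cokernel C f q"
    and mono_is_kernel: "is_mono C k \<Longrightarrow> \<exists>f. is_kernel C f k"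
    and epi_is_cokernel: "is_epi C q \<Longrightarrow> \<exists>f. is_cokernel C f q"


section \<open>Subobjects\<close>

text \<open>A subobject of \<open>L\<close> is given by a representing monomorphism into \<open>L\<close>, and an equation
  between subobjects means equivalence of representatives.\<close>

definition is_subobject :: "('o, 'm, 'x) cat_scheme \<Rightarrow> 'o \<Rightarrow> 'm \<Rightarrow> bool" where
  "is_subobject C L k \<longleftrightarrow> is_mono C k \<and> Cod C k = L"

definition sub_le :: "('o, 'm, 'x) cat_scheme \<Rightarrow> 'm \<Rightarrow> 'm \<Rightarrow> bool" where
  "sub_le C k l \<longleftrightarrow> (\<exists>h \<in> Hom C (Dom C k) (Dom C l). k = l \<cdot>\<^bsub>C\<^esub> h)"

definition sub_eq :: "('o, 'm, 'x) cat_scheme \<Rightarrow> 'm \<Rightarrow> 'm \<Rightarrow> bool" where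
  "sub_eq C k l \<longleftrightarrow> sub_le C k l \<and> sub_le C l k"

definition is_intersection :: "('o, 'm, 'x) cat_scheme \<Rightarrow> 'o \<Rightarrow> 'm \<Rightarrow> 'm \<Rightarrow> 'm \<Rightarrow> bool" where
  "is_intersection C L k x d \<longleftrightarrow> is_subobject C L d \<and> sub_le C d k \<and> sub_le C d x \<and>
    (\<forall>e. is_subobject C L e \<and> sub_le C e k \<and> sub_le C e x \<longrightarrow> sub_le C e d)"

definition is_sum :: "('o, 'm, 'x) cat_scheme \<Rightarrow> 'o \<Rightarrow> 'm \<Rightarrow> 'm \<Rightarrow> 'm \<Rightarrow> bool" where
  "is_sum C L k x s \<longleftrightarrow> is_subobject C L s \<and> sub_le C k s \<and> sub_le C x s \<and>
    (\<forall>e. is_subobject C L e \<and> sub_le C k e \<and> sub_le C x e \<longrightarrow> sub_le C s e)"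

definition is_zero_object :: "('o, 'm, 'x) cat_scheme \<Rightarrow> 'o \<Rightarrow> bool" where
  "is_zero_object C z \<longleftrightarrow> z \<in> Obj C \<and>
    (\<forall>a \<in> Obj C. (\<exists>!f. f \<in> Hom C z a) \<and> (\<exists>!f. f \<in> Hom C a z))"

definition is_zero_subobject :: "('o, 'm, 'x) cat_scheme \<Rightarrow> 'o \<Rightarrow> 'm \<Rightarrow> bool" where
  "is_zero_subobject C L x \<longleftrightarrow> is_subobject C L x \<and> is_zero_object C (Dom C x)"

definition essential :: "('o, 'm, 'x) cat_scheme \<Rightarrow> 'o \<Rightarrow> 'm \<Rightarrow> bool" where
  "essential C L k \<longleftrightarrow> is_subobject C L k \<and>
    (\<forall>x. is_subobject C L x \<longrightarrow>
      (\<exists>d. is_intersection C L k x d \<and> is_zero_subobject C L d) \<longrightarrow> is_zero_subobject C L x)"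

definition superfluous :: "('o, 'm, 'x) cat_scheme \<Rightarrow> 'o \<Rightarrow> 'm \<Rightarrow> bool" where
  "superfluous C L k \<longleftrightarrow> is_subobject C L k \<and>
    (\<forall>x. is_subobject C L x \<longrightarrow>
      (\<exists>s. is_sum C L k x s \<and> sub_eq C s (Ident C L)) \<longrightarrow> sub_eq C x (Ident C L))"

definition is_image :: "('o, 'm, 'x) preadditive_cat_scheme \<Rightarrow> 'm \<Rightarrow> 'm \<Rightarrow> bool" where
  "is_image C f m \<longleftrightarrow> (\<exists>q. is_cokernel C f q \<and> is_kernel C q m)"

definition direct_summand :: "('o, 'm, 'x) preadditive_cat_scheme \<Rightarrow> 'o \<Rightarrow> 'm \<Rightarrow> bool" where
  "direct_summand C M k \<longleftrightarrow>
    (\<exists>N \<iota> \<pi>. is_direct_sum C {1, 2::nat} N M \<iota> \<pi> \<and> \<iota> 1 = k)"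

text \<open>In the next definition \<open>k'\<close> is the subobject \<open>k\<close> of \<open>M\<close> regarded as a subobject of the
  direct summand \<open>d\<close>.\<close>

definition essential_in_direct_summand ::
  "('o, 'm, 'x) preadditive_cat_scheme \<Rightarrow> 'o \<Rightarrow> 'm \<Rightarrow> bool" where
  "essential_in_direct_summand C M k \<longleftrightarrow>
    (\<exists>d k'. direct_summand C M d \<and> k' \<in> Hom C (Dom C k) (Dom C d) \<and> k = d \<cdot>\<^bsub>C\<^esub> k' \<and>
      essential C (Dom C d) k')"

text \<open>Here \<open>h\<close> is the inclusion of the summand \<open>K\<close> in \<open>L\<close>, the cokernels \<open>q : M \<rightarrow> M/K\<close> and
  \<open>p : L \<rightarrow> L/K\<close> are the quotients, and \<open>j : L/K \<rightarrow> M/K\<close> is the induced monomorphism.\<close>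

definition lies_above_direct_summand ::
  "('o, 'm, 'x) preadditive_cat_scheme \<Rightarrow> 'o \<Rightarrow> 'm \<Rightarrow> bool" where
  "lies_above_direct_summand C M l \<longleftrightarrow> is_subobject C M l \<and>
    (\<exists>k h q p j. direct_summand C M k \<and> h \<in> Hom C (Dom C k) (Dom C l) \<and> k = l \<cdot>\<^bsub>C\<^esub> h \<and>
      is_cokernel C k q \<and> is_cokernel C h p \<and>
      j \<in> Hom C (Cod C p) (Cod C q) \<and> j \<cdot>\<^bsub>C\<^esub> p = q \<cdot>\<^bsub>C\<^esub> l \<and>
      superfluous C (Cod C q) j)"


section \<open>CS-Rickart objects\<close>

text \<open>\<open>cs_rickart C M N\<close>: \<open>N\<close> is \<open>M\<close>-CS-Rickart; \<open>dual_cs_rickart C M N\<close>: \<open>N\<close> is dual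
  \<open>M\<close>-CS-Rickart.  Kernels and images exist in an abelian category and are unique up to
  equivalence of subobjects, so the universal quantifier over representatives is harmless.\<close>

definition cs_rickart :: "('o, 'm, 'x) preadditive_cat_scheme \<Rightarrow> 'o \<Rightarrow> 'o \<Rightarrow> bool" where
  "cs_rickart C M N \<longleftrightarrow>
    (\<forall>f \<in> Hom C M N. \<forall>k. is_kernel C f k \<longrightarrow> essential_in_direct_summand C M k)"

definition dual_cs_rickart :: "('o, 'm, 'x) preadditive_cat_scheme \<Rightarrow> 'o \<Rightarrow> 'o \<Rightarrow> bool" where
  "dual_cs_rickart C M N \<longleftrightarrow>
    (\<forall>f \<in> Hom C M N. \<forall>m. is_image C f m \<longrightarrow> lies_above_direct_summand C N m)"

end

theory Submission
  imports Defs
begin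

text \<open>
  Both notions are translated into a condition on idempotents that mentions only composition and
  zero morphisms.  For \<open>f : M \<rightarrow> N\<close>, the kernel of \<open>f\<close> is essential in a direct summand of \<open>M\<close>
  exactly if there is an idempotent \<open>d : M \<rightarrow> M\<close>, a projection onto that summand, such that
  \<^item> \<open>d\<close> fixes everything that \<open>f\<close> kills, that is, \<open>Ker f \<le> Im d\<close>;
  \<^item> a morphism \<open>x\<close> with \<open>d x = x\<close> for which \<open>f x\<close> is a monomorphism has a zero object as domain:
    such an \<open>x\<close> represents a subobject of \<open>Im d\<close> that meets \<open>Ker f\<close> in zero.

  The condition makes sense for a set \<open>F\<close> of morphisms out of \<open>M\<close>, with the joint kernel in place
  of \<open>Ker f\<close>.  The kernel of a morphism \<open>f\<close> into \<open>N\<^sub>1 \<oplus> \<dots> \<oplus> N\<^sub>n\<close> is the joint kernel of the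
  components \<open>\<pi>\<^sub>i f\<close>, so part (1) amounts to adding one component at a time.  If \<open>e\<close> serves for
  \<open>F\<close>, then \<open>g\<close> is added by choosing an idempotent \<open>d\<close> that serves for \<open>g e\<close>, and the answer is the
  composite \<open>e d\<close> (\<open>essential_idempotent_insert\<close>).  It is again idempotent because \<open>g e\<close> kills
  \<open>1 - e\<close>, hence \<open>d (1 - e) = 1 - e\<close>, which forces \<open>d e d = e d\<close>.  Replacing \<open>g\<close> by \<open>g e\<close> spares the
  detour through relative versions of the property for direct summands of \<open>M\<close>.

  Part (2) is part (1) in the opposite category.  Only the translation has to be carried out
  again: the image of \<open>f\<close> lies above a direct summand of \<open>N\<close> exactly if the condition above holds
  for \<open>f\<close> in the opposite category (\<open>lies_above_direct_summand_iff\<close>).  Here the summand contained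
  in \<open>Im f\<close> is the image of \<open>1 - d\<close>, and the quotient by it is isomorphic to \<open>Im d\<close>.
\<close>

section \<open>Morphisms of a preadditive category\<close>

text \<open>The dot denotes composition only; the product of ideals is written with the same symbol.\<close>

no_notation ideal_prod (infixl "\<cdot>\<index>" 80)

context category
begin

lemma Hom_Obj: "f \<in> Hom C a b \<Longrightarrow> a \<in> Obj C" "f \<in> Hom C a b \<Longrightarrow> b \<in> Obj C"
  using Dom_Obj Cod_Obj unfolding Hom_def by auto

lemma Hom_Dom_Cod: "f \<in> Hom C a b \<Longrightarrow> Dom C f = a" "f \<in> Hom C a b \<Longrightarrow> Cod C f = b"
  "f \<in> Hom C a b \<Longrightarrow> f \<in> Arr C"
  unfolding Hom_def by auto

lemma Arr_Hom: "f \<in> Arr C \<Longrightarrow> f \<in> Hom C (Dom C f) (Cod C f)"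
  unfolding Hom_def by auto

lemma is_subobjectD: "is_subobject C L k \<Longrightarrow> is_mono C k" "is_subobject C L k \<Longrightarrow> k \<in> Hom C (Dom C k) L"
  unfolding is_subobject_def is_mono_def Hom_def by auto

end

context preadditive_category
begin

lemma Zero_Hom: "a \<in> Obj C \<Longrightarrow> b \<in> Obj C \<Longrightarrow> Zero C a b \<in> Hom C a b"
proof -
  assume "a \<in> Obj C" "b \<in> Obj C"
  then interpret G: comm_group "Hom_group C a b" by (rule Hom_comm_group)
  show ?thesis using G.one_closed by (simp add: Hom_group_def)
qed

lemma Plus_Hom:
  assumes "f \<in> Hom C a b" "g \<in> Hom C a b"
  shows "Plus C f g \<in> Hom C a b"
proof -
  interpret G: comm_group "Hom_group C a b" using assms Hom_Obj by (blast intro: Hom_comm_group)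
  show ?thesis using G.m_closed[of f g] assms by (simp add: Hom_group_def)
qed

lemma Plus_Zero:
  assumes "f \<in> Hom C a b"
  shows "Plus C f (Zero C a b) = f" "Plus C (Zero C a b) f = f"
proof -
  interpret G: comm_group "Hom_group C a b" using assms Hom_Obj by (blast intro: Hom_comm_group)
  show "Plus C f (Zero C a b) = f" "Plus C (Zero C a b) f = f"
    using G.r_one[of f] G.l_one[of f] assms by (simp_all add: Hom_group_def)
qed

lemma Plus_commute:
  assumes "f \<in> Hom C a b" "g \<in> Hom C a b"
  shows "Plus C f g = Plus C g f"
proof -
  interpret G: comm_group "Hom_group C a b" using assms Hom_Obj by (blast intro: Hom_comm_group)
  show ?thesis using G.m_comm[of f g] assms by (simp add: Hom_group_def)
qed

lemma Plus_cancel: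
  assumes "f \<in> Hom C a b" "g \<in> Hom C a b" "h \<in> Hom C a b"
  shows "Plus C f h = Plus C g h \<longleftrightarrow> f = g"
proof -
  interpret G: comm_group "Hom_group C a b" using assms Hom_Obj by (blast intro: Hom_comm_group)
  show ?thesis using G.right_cancel[of h f g] assms by (simp add: Hom_group_def)
qed

lemma ex_difference:
  assumes "f \<in> Hom C a b" "h \<in> Hom C a b"
  obtains g where "g \<in> Hom C a b" "Plus C f g = h"
proof -
  interpret G: comm_group "Hom_group C a b" using assms Hom_Obj by (blast intro: Hom_comm_group)
  have "f \<in> carrier (Hom_group C a b)" "h \<in> carrier (Hom_group C a b)"
    using assms by (simp_all add: Hom_group_def)
  then have "inv\<^bsub>Hom_group C a b\<^esub> f \<otimes>\<^bsub>Hom_group C a b\<^esub> h \<in> carrier (Hom_group C a b)"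
    "f \<otimes>\<^bsub>Hom_group C a b\<^esub> (inv\<^bsub>Hom_group C a b\<^esub> f \<otimes>\<^bsub>Hom_group C a b\<^esub> h) = h"
    by (auto simp: G.m_assoc[symmetric])
  then show thesis using that by (simp add: Hom_group_def)
qed

lemma Comp_Zero:
  assumes "a \<in> Obj C" "g \<in> Hom C b c"
  shows "g \<cdot> Zero C a b = Zero C a c"
proof -
  let ?z = "Zero C a b"
  have o: "b \<in> Obj C" "c \<in> Obj C" using assms Hom_Obj by auto
  have z: "?z \<in> Hom C a b" "g \<cdot> ?z \<in> Hom C a c" "Zero C a c \<in> Hom C a c"
    using assms o by (blast intro: Zero_Hom Comp_Hom)+
  have "Plus C (g \<cdot> ?z) (g \<cdot> ?z) = g \<cdot> Plus C ?z ?z" using z assms Comp_Plus by metis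
  also have "\<dots> = Plus C (Zero C a c) (g \<cdot> ?z)" using Plus_Zero z by simp
  finally show ?thesis using Plus_cancel z by blast
qed

lemma Zero_Comp:
  assumes "c \<in> Obj C" "f \<in> Hom C a b"
  shows "Zero C b c \<cdot> f = Zero C a c"
proof -
  let ?z = "Zero C b c"
  have o: "a \<in> Obj C" "b \<in> Obj C" using assms Hom_Obj by auto
  have z: "?z \<in> Hom C b c" "?z \<cdot> f \<in> Hom C a c" "Zero C a c \<in> Hom C a c"
    using assms o by (blast intro: Zero_Hom Comp_Hom)+
  have "Plus C (?z \<cdot> f) (?z \<cdot> f) = Plus C ?z ?z \<cdot> f" using z assms Plus_Comp by metis
  also have "\<dots> = Plus C (Zero C a c) (?z \<cdot> f)" using Plus_Zero z by simp
  finally show ?thesis using Plus_cancel z by blast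
qed

lemma is_mono_iff:
  assumes f: "f \<in> Hom C a b"
  shows "is_mono C f \<longleftrightarrow> (\<forall>c. \<forall>t \<in> Hom C c a. f \<cdot> t = Zero C c b \<longrightarrow> t = Zero C c a)"
proof
  assume m: "is_mono C f"
  show "\<forall>c. \<forall>t \<in> Hom C c a. f \<cdot> t = Zero C c b \<longrightarrow> t = Zero C c a"
  proof (intro allI ballI impI)
    fix c t assume t: "t \<in> Hom C c a" "f \<cdot> t = Zero C c b"
    have "f \<cdot> t = f \<cdot> Zero C c a" "Zero C c a \<in> Hom C c a"
      using t f Comp_Zero Zero_Hom Hom_Obj by auto
    then show "t = Zero C c a" using m t f Hom_Dom_Cod unfolding is_mono_def by metis
  qed
next
  assume r: "\<forall>c. \<forall>t \<in> Hom C c a. f \<cdot> t = Zero C c b \<longrightarrow> t = Zero C c a"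
  have "g = h" if gh: "g \<in> Hom C c a" "h \<in> Hom C c a" "f \<cdot> g = f \<cdot> h" for c g h
  proof -
    obtain n where n: "n \<in> Hom C c a" "Plus C h n = Zero C c a"
      using ex_difference[of h c a "Zero C c a"] gh Zero_Hom Hom_Obj by metis
    have "f \<cdot> Plus C g n = f \<cdot> Plus C h n" using gh n f Comp_Plus by metis
    also have "\<dots> = Zero C c b" using n f Comp_Zero Hom_Obj gh by metis
    finally have "Plus C g n = Plus C h n" using r n gh Plus_Hom by metis
    then show "g = h" using Plus_cancel gh n by blast
  qed
  then show "is_mono C f" using f Hom_Dom_Cod unfolding is_mono_def by metis
qed

lemma is_mono_cancel_Zero:
  "is_mono C f \<Longrightarrow> f \<in> Hom C a b \<Longrightarrow> t \<in> Hom C c a \<Longrightarrow> f \<cdot> t = Zero C c b \<Longrightarrow> t = Zero C c a"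
  using is_mono_iff by blast

lemma is_mono_cancel:
  "is_mono C f \<Longrightarrow> f \<in> Hom C a b \<Longrightarrow> t \<in> Hom C c a \<Longrightarrow> s \<in> Hom C c a \<Longrightarrow> f \<cdot> t = f \<cdot> s \<Longrightarrow> t = s"
  using Hom_Dom_Cod unfolding is_mono_def by metis

lemma is_kernelD:
  assumes "is_kernel C f k" "f \<in> Hom C a b"
  shows "k \<in> Hom C (Dom C k) a" "f \<cdot> k = Zero C (Dom C k) b"
    "\<And>c g. g \<in> Hom C c a \<Longrightarrow> f \<cdot> g = Zero C c b \<Longrightarrow> \<exists>u \<in> Hom C c (Dom C k). k \<cdot> u = g"
  using assms Hom_Dom_Cod Arr_Hom unfolding is_kernel_def by metis+

lemma is_kernel_imp_is_mono:
  assumes k: "is_kernel C f k"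
  shows "is_mono C k"
proof -
  obtain a b where f: "f \<in> Hom C a b" using k Arr_Hom unfolding is_kernel_def by blast
  note D = is_kernelD[OF k f]
  have "t = Zero C c (Dom C k)" if t: "t \<in> Hom C c (Dom C k)" "k \<cdot> t = Zero C c a" for c t
  proof -
    have o: "c \<in> Obj C" "Dom C k \<in> Obj C" "a \<in> Obj C" using t Hom_Obj D(1) by auto
    then have "k \<cdot> t = k \<cdot> Zero C c (Dom C k)" "Zero C c (Dom C k) \<in> Hom C c (Dom C k)"
      "f \<cdot> Zero C c a = Zero C c b" "Zero C c a \<in> Hom C c a"
      using t Comp_Zero D(1) Zero_Hom f by auto
    then show ?thesis
      using k t f Hom_Dom_Cod unfolding is_kernel_def by metis
  qed
  then show ?thesis using is_mono_iff[OF D(1)] by blast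
qed

lemma is_zero_object_iff:
  assumes "a \<in> Obj C"
  shows "is_zero_object C a \<longleftrightarrow> Ident C a = Zero C a a"
proof
  show "is_zero_object C a \<Longrightarrow> Ident C a = Zero C a a"
    using assms Ident_Hom Zero_Hom unfolding is_zero_object_def by blast
next
  assume I: "Ident C a = Zero C a a"
  have "f = Zero C a b" if "f \<in> Hom C a b" for b f
    using that I Comp_Ident Comp_Zero assms by metis
  moreover have "f = Zero C b a" if "f \<in> Hom C b a" for b f
    using that I Ident_Comp Zero_Comp assms by metis
  ultimately show "is_zero_object C a"
    using assms Zero_Hom unfolding is_zero_object_def by metis
qed

lemma zero_object_Hom:
  assumes "is_zero_object C a"
  shows "f \<in> Hom C a b \<Longrightarrow> f = Zero C a b" "f \<in> Hom C b a \<Longrightarrow> f = Zero C b a"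
  using assms Hom_Obj Zero_Hom unfolding is_zero_object_def by metis+

text \<open>The complement of \<open>d\<close> is \<open>e = 1 - d\<close>.  Being fixed by one of the two idempotents is the same as
  being killed by the other, on either side, which turns every later computation with \<open>1 - d\<close> into
  an equation between composites.\<close>

lemma ex_complement:
  assumes d: "d \<in> Hom C M M" "d \<cdot> d = d"
  obtains e where "e \<in> Hom C M M" "Plus C d e = Ident C M" "e \<cdot> e = e"
    "d \<cdot> e = Zero C M M" "e \<cdot> d = Zero C M M"
    "\<And>a t. t \<in> Hom C a M \<Longrightarrow> d \<cdot> t = t \<longleftrightarrow> e \<cdot> t = Zero C a M"
    "\<And>a t. t \<in> Hom C a M \<Longrightarrow> e \<cdot> t = t \<longleftrightarrow> d \<cdot> t = Zero C a M"
    "\<And>b t. t \<in> Hom C M b \<Longrightarrow> t \<cdot> d = t \<longleftrightarrow> t \<cdot> e = Zero C M b"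
    "\<And>b t. t \<in> Hom C M b \<Longrightarrow> t \<cdot> e = t \<longleftrightarrow> t \<cdot> d = Zero C M b"
proof -
  have M: "M \<in> Obj C" using d Hom_Obj by auto
  obtain e where e: "e \<in> Hom C M M" "Plus C d e = Ident C M"
    using ex_difference d(1) Ident_Hom[OF M] by metis
  have L: "Plus C (d \<cdot> t) (e \<cdot> t) = t" "e \<cdot> t \<in> Hom C a M" "d \<cdot> t \<in> Hom C a M"
     "Zero C a M \<in> Hom C a M"
    if t: "t \<in> Hom C a M" for a t
    using t d e M Plus_Comp Ident_Comp Comp_Hom Zero_Hom Hom_Obj by metis+
  have R: "Plus C (t \<cdot> d) (t \<cdot> e) = t" "t \<cdot> e \<in> Hom C M b" "t \<cdot> d \<in> Hom C M b"
     "Zero C M b \<in> Hom C M b"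
    if t: "t \<in> Hom C M b" for b t
    using t d e M Comp_Plus Comp_Ident Comp_Hom Zero_Hom Hom_Obj by metis+
  have split: "u = w \<longleftrightarrow> v = Zero C a b" "v = w \<longleftrightarrow> u = Zero C a b"
    if "u \<in> Hom C a b" "v \<in> Hom C a b" "Zero C a b \<in> Hom C a b" "Plus C u v = w" for u v w a b
    using that Plus_Zero Plus_cancel Plus_commute by metis+
  have 1: "d \<cdot> t = t \<longleftrightarrow> e \<cdot> t = Zero C a M" "e \<cdot> t = t \<longleftrightarrow> d \<cdot> t = Zero C a M"
    if "t \<in> Hom C a M" for a t
    using split L[OF that] by blast+
  have 2: "t \<cdot> d = t \<longleftrightarrow> t \<cdot> e = Zero C M b" "t \<cdot> e = t \<longleftrightarrow> t \<cdot> d = Zero C M b"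
    if "t \<in> Hom C M b" for b t
    using split R[OF that] by blast+
  have "e \<cdot> d = Zero C M M" "d \<cdot> e = Zero C M M" using 1 2 d by blast+
  moreover from this have "e \<cdot> e = e" using 1 e by blast
  ultimately show thesis using that 1 2 e by blast
qed

end

section \<open>Essential idempotents\<close>

text \<open>An abelian category and its opposite both have this structure, so one argument in it serves
  both kernels and images.\<close>

locale preadditive_category_with_kernels = preadditive_category C
  for C :: "('o, 'm, 'x) preadditive_cat_scheme" (structure) +
  assumes ex_kernel: "f \<in> Arr C \<Longrightarrow> \<exists>k. is_kernel C f k"

text \<open>The morphisms \<open>t\<close> annihilated by \<open>F\<close> are those that factor through the joint kernel of \<open>F\<close>.\<close>

definition annihilates :: "('o, 'm, 'x) preadditive_cat_scheme \<Rightarrow> 'm set \<Rightarrow> 'm \<Rightarrow> bool" where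
  "annihilates C F t \<longleftrightarrow> (\<forall>f\<in>F. f \<cdot>\<^bsub>C\<^esub> t = Zero C (Dom C t) (Cod C f))"

text \<open>The joint kernel of \<open>F\<close> is contained in the image of the idempotent \<open>d\<close> and is essential
  there.  The innermost premise on \<open>x\<close> says that \<open>x\<close> followed by \<open>F\<close> is jointly monic, so \<open>x\<close> itself is
  monic; the conclusion says that its domain is a zero object.\<close>

definition essential_idempotent ::
  "('o, 'm, 'x) preadditive_cat_scheme \<Rightarrow> 'o \<Rightarrow> 'm set \<Rightarrow> 'm \<Rightarrow> bool" where
  "essential_idempotent C M F d \<longleftrightarrow> d \<in> Hom C M M \<and> d \<cdot>\<^bsub>C\<^esub> d = d \<and>
    (\<forall>a. \<forall>t \<in> Hom C a M. annihilates C F t \<longrightarrow> d \<cdot>\<^bsub>C\<^esub> t = t) \<and>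
    (\<forall>a. \<forall>x \<in> Hom C a M. d \<cdot>\<^bsub>C\<^esub> x = x \<longrightarrow>
      (\<forall>b. \<forall>t \<in> Hom C b a. annihilates C F (x \<cdot>\<^bsub>C\<^esub> t) \<longrightarrow> t = Zero C b a) \<longrightarrow>
      Ident C a = Zero C a a)"

definition has_essential_idempotents ::
  "('o, 'm, 'x) preadditive_cat_scheme \<Rightarrow> 'o \<Rightarrow> 'o \<Rightarrow> bool" where
  "has_essential_idempotents C M N \<longleftrightarrow>
    (\<forall>f \<in> Hom C M N. \<exists>d. essential_idempotent C M {f} d)"

lemma essential_idempotent_cong:
  assumes "\<And>a t. t \<in> Hom C a M \<Longrightarrow> annihilates C F t \<longleftrightarrow> annihilates C G t"
    and "category C"
  shows "essential_idempotent C M F d \<longleftrightarrow> essential_idempotent C M G d"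
proof -
  interpret category C by fact
  show ?thesis
    unfolding essential_idempotent_def using assms(1) Comp_Hom by (smt (verit, ccfv_SIG))
qed

context preadditive_category
begin

lemma annihilates_single:
  "f \<in> Hom C a b \<Longrightarrow> t \<in> Hom C c a \<Longrightarrow> annihilates C {f} t \<longleftrightarrow> f \<cdot> t = Zero C c b"
  using Hom_Dom_Cod unfolding annihilates_def by auto

text \<open>The joint kernel of no morphisms is all of \<open>M\<close>.\<close>

lemma essential_idempotent_empty:
  assumes "M \<in> Obj C"
  shows "essential_idempotent C M {} (Ident C M)"
proof -
  have "Ident C a = Zero C a a"
    if "x \<in> Hom C a M" "\<forall>b. \<forall>t \<in> Hom C b a. annihilates C {} (x \<cdot> t) \<longrightarrow> t = Zero C b a" for a x
    using that Hom_Obj Ident_Hom unfolding annihilates_def by blast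
  then show ?thesis
    using assms Ident_Hom Ident_Comp unfolding essential_idempotent_def by blast
qed

lemma finprod_Comp_eq_Zero:
  assumes "finite I" "\<And>i. i \<in> I \<Longrightarrow> F i \<in> Hom C a b" "t \<in> Hom C c a" "b \<in> Obj C"
    and "\<And>i. i \<in> I \<Longrightarrow> F i \<cdot> t = Zero C c b"
  shows "finprod (Hom_group C a b) F I \<cdot> t = Zero C c b"
proof -
  interpret G: comm_group "Hom_group C a b" using assms Hom_Obj by (blast intro: Hom_comm_group)
  have car: "carrier (Hom_group C a b) = Hom C a b" by (simp add: Hom_group_def)
  from assms show ?thesis
  proof (induction I rule: finite_induct)
    case empty
    have "finprod (Hom_group C a b) F {} = Zero C a b"
      by (simp only: G.finprod_empty) (simp add: Hom_group_def)
    then show ?case using Zero_Comp empty.prems by simp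
  next
    case (insert i I)
    have F: "F \<in> I \<rightarrow> carrier (Hom_group C a b)" "F i \<in> carrier (Hom_group C a b)"
      using insert.prems by (auto simp: car)
    have P: "finprod (Hom_group C a b) F I \<in> Hom C a b"
      using G.finprod_closed[OF F(1)] by (simp add: car)
    have "finprod (Hom_group C a b) F (insert i I) = Plus C (F i) (finprod (Hom_group C a b) F I)"
      using G.finprod_insert[OF insert.hyps F] by (simp add: Hom_group_def)
    moreover have "Plus C (F i) (finprod (Hom_group C a b) F I) \<cdot> t
      = Plus C (F i \<cdot> t) (finprod (Hom_group C a b) F I \<cdot> t)"
      using Plus_Comp[OF insert.prems(2) _ P] insert.prems(1) by blast
    moreover have "Zero C c b \<in> Hom C c b" using Zero_Hom Hom_Obj insert.prems by metis
    ultimately show ?case using insert Plus_Zero by auto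
  qed
qed

text \<open>Applied to composites \<open>f t\<close>, this says that the kernel of a morphism \<open>f\<close> into a direct sum is the
  joint kernel of its components.\<close>

lemma direct_sum_eq_Zero_iff:
  assumes S: "is_direct_sum C I N S \<iota> \<pi>" and t: "t \<in> Hom C a S"
  shows "t = Zero C a S \<longleftrightarrow> (\<forall>i\<in>I. \<pi> i \<cdot> t = Zero C a (N i))"
proof
  have o: "a \<in> Obj C" "S \<in> Obj C" using t Hom_Obj by auto
  show "t = Zero C a S \<Longrightarrow> \<forall>i\<in>I. \<pi> i \<cdot> t = Zero C a (N i)"
    using S Comp_Zero o unfolding is_direct_sum_def by auto
  assume *: "\<forall>i\<in>I. \<pi> i \<cdot> t = Zero C a (N i)"
  have S': "\<iota> i \<in> Hom C (N i) S" "\<pi> i \<in> Hom C S (N i)" if "i \<in> I" for i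
    using S that unfolding is_direct_sum_def by auto
  have "(\<iota> i \<cdot> \<pi> i) \<cdot> t = Zero C a S" if "i \<in> I" for i
  proof -
    have "(\<iota> i \<cdot> \<pi> i) \<cdot> t = \<iota> i \<cdot> (\<pi> i \<cdot> t)" using Comp_assoc[OF t S'(2,1)] that by blast
    also have "\<dots> = Zero C a S" using * that Comp_Zero[OF o(1) S'(1)] by simp
    finally show ?thesis .
  qed
  then have "finprod (Hom_group C S S) (\<lambda>i. \<iota> i \<cdot> \<pi> i) I \<cdot> t = Zero C a S"
    using S S' o t by (intro finprod_Comp_eq_Zero) (auto simp: is_direct_sum_def intro: Comp_Hom)
  then show "t = Zero C a S"
    using S t Ident_Comp unfolding is_direct_sum_def by auto
qed

end

context preadditive_category_with_kernels
begin

text \<open>The image of \<open>e d\<close> is the intersection of \<open>Im e\<close> and \<open>Im d\<close>.  Essentiality combines in two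
  steps.  Let \<open>x\<close> land in both images and be jointly monic after \<open>F\<close> and \<open>g\<close>.  On the kernel of
  \<open>g x\<close> the family \<open>F\<close> alone is already jointly monic, so this kernel vanishes because \<open>e\<close> is
  essential for \<open>F\<close>.  Therefore \<open>g x = g e x\<close> is monic, and \<open>x\<close> vanishes because \<open>d\<close> is essential for
  \<open>g e\<close>.\<close>

lemma essential_idempotent_insert:
  assumes e: "essential_idempotent C M F e" and F: "\<And>f. f \<in> F \<Longrightarrow> f \<in> Arr C \<and> Dom C f = M"
    and g: "g \<in> Hom C M N" and d: "essential_idempotent C M {g \<cdot> e} d"
  shows "essential_idempotent C M (insert g F) (e \<cdot> d)"
proof -
  have eH: "e \<in> Hom C M M" "e \<cdot> e = e" and dH: "d \<in> Hom C M M" "d \<cdot> d = d"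
    using e d unfolding essential_idempotent_def by auto
  have o: "M \<in> Obj C" "N \<in> Obj C" using g Hom_Obj by auto
  have geH: "g \<cdot> e \<in> Hom C M N" and pH: "e \<cdot> d \<in> Hom C M M" using g eH dH Comp_Hom by blast+
  obtain e' where e': "e' \<in> Hom C M M" "Plus C e e' = Ident C M" "e \<cdot> e' = Zero C M M"
    by (rule ex_complement[OF eH]) (rule that; assumption)
  have ins: "annihilates C (insert g F) t \<longleftrightarrow> g \<cdot> t = Zero C a N \<and> annihilates C F t"
    if "t \<in> Hom C a M" for a t
    using that g Hom_Dom_Cod unfolding annihilates_def by auto
  have d_fix: "d \<cdot> t = t" if "t \<in> Hom C a M" "(g \<cdot> e) \<cdot> t = Zero C a N" for a t
    using d that annihilates_single[OF geH] unfolding essential_idempotent_def by blast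
  \<comment> \<open>The complement of \<open>e\<close> lies in the kernel of \<open>g e\<close>, hence in the image of \<open>d\<close>; this is what
    makes the images of \<open>e\<close> and \<open>d\<close> compatible.\<close>
  have "(g \<cdot> e) \<cdot> e' = Zero C M N"
    using e' eH g o Comp_assoc Comp_Zero by metis
  then have de': "d \<cdot> e' = e'" using d_fix e' by blast
  have ded: "d \<cdot> (e \<cdot> d) = e \<cdot> d"
  proof -
    have "d = Plus C (e \<cdot> d) (e' \<cdot> d)"
      using e' eH dH o Ident_Comp Plus_Comp by metis
    moreover have "d \<cdot> (e' \<cdot> d) = e' \<cdot> d" using de' dH e' Comp_assoc by metis
    ultimately have "Plus C (d \<cdot> (e \<cdot> d)) (e' \<cdot> d) = Plus C (e \<cdot> d) (e' \<cdot> d)"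
      using Comp_Plus[of "e \<cdot> d" M M "e' \<cdot> d" d M] pH e' dH Comp_Hom by metis
    then show ?thesis using Plus_cancel pH dH e' Comp_Hom by blast
  qed
  have ep: "e \<cdot> (e \<cdot> d) = e \<cdot> d" using eH dH Comp_assoc by metis
  have pp: "(e \<cdot> d) \<cdot> (e \<cdot> d) = e \<cdot> d"
    using ded ep eH dH pH Comp_assoc by metis
  have fix_p: "(e \<cdot> d) \<cdot> t = t" if t: "t \<in> Hom C a M" "annihilates C (insert g F) t" for a t
  proof -
    have 1: "e \<cdot> t = t" using t ins e unfolding essential_idempotent_def by blast
    then have "d \<cdot> t = t" using d_fix t ins Comp_assoc eH g by metis
    then show ?thesis using 1 t eH dH Comp_assoc by metis
  qed
  have zero_p: "Ident C a = Zero C a a"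
    if x: "x \<in> Hom C a M" "(e \<cdot> d) \<cdot> x = x"
      and mono: "\<And>b t. t \<in> Hom C b a \<Longrightarrow> annihilates C (insert g F) (x \<cdot> t) \<Longrightarrow> t = Zero C b a"
    for a x
  proof -
    have ex: "e \<cdot> x = x" using x ep eH pH Comp_assoc by metis
    have dx: "d \<cdot> x = x" using x ded dH pH Comp_assoc by metis
    have gx: "g \<cdot> x \<in> Hom C a N" using g x Comp_Hom by blast
    \<comment> \<open>The part of \<open>x\<close> killed by \<open>g\<close> is controlled by \<open>F\<close>, hence by \<open>e\<close>.\<close>
    obtain k where k: "is_kernel C (g \<cdot> x) k" using ex_kernel gx Hom_Dom_Cod by metis
    note kD = is_kernelD[OF k gx]
    let ?K = "Dom C k"
    have kO: "?K \<in> Obj C" using kD Hom_Obj by auto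
    have xk: "x \<cdot> k \<in> Hom C ?K M" using x kD Comp_Hom by blast
    have "Ident C ?K = Zero C ?K ?K"
    proof -
      have "e \<cdot> (x \<cdot> k) = x \<cdot> k" using ex eH x kD Comp_assoc by metis
      moreover have "t = Zero C b ?K"
        if t: "t \<in> Hom C b ?K" "annihilates C F ((x \<cdot> k) \<cdot> t)" for b t
      proof -
        have kt: "k \<cdot> t \<in> Hom C b a" "b \<in> Obj C" "(x \<cdot> k) \<cdot> t = x \<cdot> (k \<cdot> t)"
          using t kD x Comp_Hom Hom_Obj Comp_assoc by metis+
        have "g \<cdot> (x \<cdot> (k \<cdot> t)) = (g \<cdot> x) \<cdot> (k \<cdot> t)" using kt x g Comp_assoc by metis
        also have "\<dots> = ((g \<cdot> x) \<cdot> k) \<cdot> t" using Comp_assoc[OF t(1) kD(1) gx] by simp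
        also have "\<dots> = Zero C b N" using kD(2) Zero_Comp[OF o(2) t(1)] by simp
        finally have "annihilates C (insert g F) (x \<cdot> (k \<cdot> t))"
          using ins[OF Comp_Hom[OF kt(1) x(1)]] t(2) kt(3) by simp
        then have "k \<cdot> t = Zero C b a" using mono[OF kt(1)] by simp
        then show ?thesis
          using is_mono_cancel_Zero[OF is_kernel_imp_is_mono[OF k] kD(1) t(1)] by blast
      qed
      ultimately show ?thesis using e xk unfolding essential_idempotent_def by blast
    qed
    then have k0: "k = Zero C ?K a" using zero_object_Hom(1) is_zero_object_iff kO kD(1) by blast
    have "t = Zero C b a" if t: "t \<in> Hom C b a" "annihilates C {g \<cdot> e} (x \<cdot> t)" for b t
    proof -
      have "(g \<cdot> e) \<cdot> (x \<cdot> t) = Zero C b N"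
        using t annihilates_single geH x Comp_Hom by blast
      moreover have "(g \<cdot> e) \<cdot> (x \<cdot> t) = (g \<cdot> x) \<cdot> t"
        using Comp_assoc[OF t(1) x(1) geH] Comp_assoc[OF x(1) eH(1) g] ex by simp
      ultimately obtain u where "u \<in> Hom C b ?K" "k \<cdot> u = t" using kD(3) t by metis
      then show ?thesis using k0 Zero_Comp x Hom_Obj(1) by metis
    qed
    then show ?thesis using d x dx unfolding essential_idempotent_def by blast
  qed
  show ?thesis
    unfolding essential_idempotent_def using pH pp fix_p zero_p by blast
qed

text \<open>The last assumption ranges over all \<open>f e\<close> because the induction precomposes each new morphism
  with the idempotent found so far.\<close>

lemma ex_essential_idempotent_finite:
  assumes "finite F" "M \<in> Obj C" "\<And>f. f \<in> F \<Longrightarrow> f \<in> Arr C \<and> Dom C f = M"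
    and "\<And>f e. f \<in> F \<Longrightarrow> e \<in> Hom C M M \<Longrightarrow> \<exists>d. essential_idempotent C M {f \<cdot> e} d"
  shows "\<exists>d. essential_idempotent C M F d"
  using assms
proof (induction F rule: finite_induct)
  case empty
  then show ?case using essential_idempotent_empty by blast
next
  case (insert g F)
  then obtain e where e: "essential_idempotent C M F e" by auto
  then have "e \<in> Hom C M M" unfolding essential_idempotent_def by blast
  then obtain d where "essential_idempotent C M {g \<cdot> e} d" using insert.prems(3)[of g e] by blast
  moreover have "g \<in> Hom C M (Cod C g)" using insert.prems(2)[of g] Arr_Hom by force
  ultimately show ?case using essential_idempotent_insert[OF e] insert.prems(2) by blast
qed

text \<open>From the direct sum to a summand: following \<open>f\<close> by the monomorphism \<open>\<iota> i\<close> does not change its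
  kernel.  Conversely, the kernel of a morphism into the sum is the joint kernel of its components.\<close>

theorem has_essential_idempotents_direct_sum:
  assumes S: "is_direct_sum C I N S \<iota> \<pi>" and M: "M \<in> Obj C"
  shows "has_essential_idempotents C M S \<longleftrightarrow> (\<forall>i\<in>I. has_essential_idempotents C M (N i))"
proof
  have S': "\<iota> i \<in> Hom C (N i) S" "\<pi> i \<in> Hom C S (N i)" "\<pi> i \<cdot> \<iota> i = Ident C (N i)"
    if "i \<in> I" for i
    using S that unfolding is_direct_sum_def by auto
  {
    assume h: "has_essential_idempotents C M S"
    show "\<forall>i\<in>I. has_essential_idempotents C M (N i)"
      unfolding has_essential_idempotents_def
    proof (intro ballI)
      fix i f assume i: "i \<in> I" and f: "f \<in> Hom C M (N i)"
      have "\<iota> i \<cdot> f \<in> Hom C M S" using f S' i Comp_Hom by blast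
      moreover have "annihilates C {\<iota> i \<cdot> f} t \<longleftrightarrow> annihilates C {f} t"
        if t: "t \<in> Hom C a M" for a t
      proof -
        have ft: "f \<cdot> t \<in> Hom C a (N i)" "(\<iota> i \<cdot> f) \<cdot> t = \<iota> i \<cdot> (f \<cdot> t)" "a \<in> Obj C"
          using t f S' i Comp_Hom Comp_assoc Hom_Obj by metis+
        have "f \<cdot> t = \<pi> i \<cdot> (\<iota> i \<cdot> (f \<cdot> t))"
          using Comp_assoc[OF ft(1) S'(1)[OF i] S'(2)[OF i]] S'(3)[OF i] Ident_Comp[OF ft(1)] by simp
        then have "\<iota> i \<cdot> (f \<cdot> t) = Zero C a S \<longleftrightarrow> f \<cdot> t = Zero C a (N i)"
          using Comp_Zero[OF ft(3) S'(1)[OF i]] Comp_Zero[OF ft(3) S'(2)[OF i]] by auto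
        then show ?thesis
          using annihilates_single[OF calculation t] annihilates_single[OF f t] ft(2) by simp
      qed
      ultimately show "\<exists>d. essential_idempotent C M {f} d"
        using h essential_idempotent_cong category_axioms unfolding has_essential_idempotents_def
        by (metis (lifting))
    qed
  next
    assume h: "\<forall>i\<in>I. has_essential_idempotents C M (N i)"
    show "has_essential_idempotents C M S"
      unfolding has_essential_idempotents_def
    proof (intro ballI)
      fix f assume f: "f \<in> Hom C M S"
      let ?F = "(\<lambda>i. \<pi> i \<cdot> f) ` I"
      have pf: "\<pi> i \<cdot> f \<in> Hom C M (N i)" if "i \<in> I" for i
        using that f S' Comp_Hom by blast
      have "\<exists>d. essential_idempotent C M ?F d"
      proof (rule ex_essential_idempotent_finite)
        show "finite ?F" using S unfolding is_direct_sum_def by auto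
        show "g \<in> Arr C \<and> Dom C g = M" if "g \<in> ?F" for g
          using that pf Hom_Dom_Cod by blast
        show "\<exists>d. essential_idempotent C M {g \<cdot> e} d" if "g \<in> ?F" "e \<in> Hom C M M" for g e
          using that h pf Comp_Hom unfolding has_essential_idempotents_def by blast
      qed fact
      moreover have "annihilates C ?F t \<longleftrightarrow> annihilates C {f} t" if t: "t \<in> Hom C a M" for a t
      proof -
        have ft: "f \<cdot> t \<in> Hom C a S" using f t Comp_Hom by blast
        have "annihilates C ?F t \<longleftrightarrow> (\<forall>i\<in>I. (\<pi> i \<cdot> f) \<cdot> t = Zero C a (N i))"
          using Hom_Dom_Cod(2)[OF pf] Hom_Dom_Cod(1)[OF t] unfolding annihilates_def by simp
        also have "\<dots> \<longleftrightarrow> (\<forall>i\<in>I. \<pi> i \<cdot> (f \<cdot> t) = Zero C a (N i))"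
          using S' f t Comp_assoc by metis
        also have "\<dots> \<longleftrightarrow> annihilates C {f} t"
          using direct_sum_eq_Zero_iff[OF S ft] annihilates_single[OF f t] by blast
        finally show ?thesis .
      qed
      ultimately show "\<exists>d. essential_idempotent C M {f} d"
        using essential_idempotent_cong[of C M ?F "{f}"] category_axioms by blast
    qed
  }
qed

text \<open>An idempotent with complement \<open>e\<close> splits through the kernel of \<open>e\<close>, so splitting both \<open>d\<close> and \<open>e\<close>
  produces the two summands.\<close>

lemma ex_splitting:
  assumes d: "d \<in> Hom C M M" "d \<cdot> d = d"
  obtains N \<iota> \<pi> where "is_direct_sum C {1, 2::nat} N M \<iota> \<pi>" "\<iota> 1 \<cdot> \<pi> 1 = d"
proof -
  have M: "M \<in> Obj C" using d Hom_Obj by auto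
  obtain e where e: "e \<in> Hom C M M" "e \<cdot> e = e" "Plus C d e = Ident C M"
      "d \<cdot> e = Zero C M M" "e \<cdot> d = Zero C M M"
    by (rule ex_complement[OF d]) (rule that; assumption)
  have one: "\<exists>A i p. i \<in> Hom C A M \<and> p \<in> Hom C M A \<and> p \<cdot> i = Ident C A \<and> i \<cdot> p = d"
    if d: "d \<in> Hom C M M" "d \<cdot> d = d" for d
  proof -
    obtain e where e: "e \<in> Hom C M M" "e \<cdot> d = Zero C M M"
        "\<And>a t. t \<in> Hom C a M \<Longrightarrow> d \<cdot> t = t \<longleftrightarrow> e \<cdot> t = Zero C a M"
      by (rule ex_complement[OF d]) (rule that; assumption)
    obtain i where i: "is_kernel C e i" using ex_kernel e Hom_Dom_Cod by metis
    note D = is_kernelD[OF i e(1)]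
    obtain p where p: "p \<in> Hom C M (Dom C i)" "i \<cdot> p = d" using D(3)[OF d(1) e(2)] by blast
    have "i \<cdot> (p \<cdot> i) = i \<cdot> Ident C (Dom C i)"
      using p D e(3) Comp_assoc Comp_Ident by metis
    then have "p \<cdot> i = Ident C (Dom C i)"
      using is_mono_cancel[OF is_kernel_imp_is_mono[OF i] D(1)] p D(1) Comp_Hom Ident_Hom Hom_Obj
      by metis
    then show ?thesis using p D(1) by blast
  qed
  obtain A i p where A: "i \<in> Hom C A M" "p \<in> Hom C M A" "p \<cdot> i = Ident C A" "i \<cdot> p = d"
    using one[OF d] by blast
  obtain B j q where B: "j \<in> Hom C B M" "q \<in> Hom C M B" "q \<cdot> j = Ident C B" "j \<cdot> q = e"
    using one[OF e(1,2)] by blast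
  have AB: "A \<in> Obj C" "B \<in> Obj C" using A B Hom_Obj by auto
  have cross: "s \<cdot> i = Zero C A B"
    if "i \<in> Hom C A M" "p \<in> Hom C M A" "p \<cdot> i = Ident C A"
       "j \<in> Hom C B M" "s \<in> Hom C M B" "s \<cdot> j = Ident C B"
       "(j \<cdot> s) \<cdot> (i \<cdot> p) = Zero C M M" for i A p j B s
  proof -
    have ob: "A \<in> Obj C" "B \<in> Obj C" using that Hom_Obj by auto
    have si: "s \<cdot> i \<in> Hom C A B" using that Comp_Hom by blast
    have js: "j \<cdot> s \<in> Hom C M M" "(j \<cdot> s) \<cdot> i \<in> Hom C A M" using that Comp_Hom by blast+
    have "(j \<cdot> s) \<cdot> i = ((j \<cdot> s) \<cdot> i) \<cdot> (p \<cdot> i)" using that(3) js(2) Comp_Ident by simp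
    also have "\<dots> = ((j \<cdot> s) \<cdot> (i \<cdot> p)) \<cdot> i"
      using Comp_assoc[OF that(1,2) js(2)] Comp_assoc[OF that(2,1) js(1)] by simp
    also have "\<dots> = Zero C A M" using that(7) Zero_Comp[OF M that(1)] by simp
    finally have jsi: "(j \<cdot> s) \<cdot> i = Zero C A M" .
    have "s \<cdot> i = (s \<cdot> j) \<cdot> (s \<cdot> i)" using that(6) si Ident_Comp by simp
    also have "\<dots> = s \<cdot> ((j \<cdot> s) \<cdot> i)"
      using Comp_assoc[OF si that(4,5)] Comp_assoc[OF that(1,5,4)] by simp
    also have "\<dots> = Zero C A B" using jsi Comp_Zero[OF ob(1) that(5)] by simp
    finally show ?thesis .
  qed
  have 1: "q \<cdot> i = Zero C A B" using cross[OF A(1,2,3) B(1,2,3)] A(4) B(4) e(5) by simp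
  have 2: "p \<cdot> j = Zero C B A" using cross[OF B(1,2,3) A(1,2,3)] A(4) B(4) e(4) by simp
  interpret G: comm_group "Hom_group C M M" using M by (blast intro: Hom_comm_group)
  define \<iota> where "\<iota> = (\<lambda>n::nat. if n = 1 then i else j)"
  define \<pi> where "\<pi> = (\<lambda>n::nat. if n = 1 then p else q)"
  define N where "N = (\<lambda>n::nat. if n = 1 then A else B)"
  have "finprod (Hom_group C M M) (\<lambda>n. \<iota> n \<cdot> \<pi> n) {1, 2} = Plus C d e"
  proof -
    let ?F = "\<lambda>n. \<iota> n \<cdot> \<pi> n"
    have F: "?F \<in> {1, 2} \<rightarrow> carrier (Hom_group C M M)" "?F 1 = d" "?F 2 = e"
      using A(4) B(4) d e by (auto simp: \<iota>_def \<pi>_def Hom_group_def)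
    have "finprod (Hom_group C M M) ?F {1, 2} = ?F 1 \<otimes>\<^bsub>Hom_group C M M\<^esub> ?F 2"
      using F(1) by (subst G.finprod_insert) auto
    then show ?thesis using F by (simp add: Hom_group_def)
  qed
  then have "is_direct_sum C {1, 2::nat} N M \<iota> \<pi>"
    unfolding is_direct_sum_def using A B AB 1 2 M e(3) by (simp add: \<iota>_def \<pi>_def N_def)
  moreover have "\<iota> 1 \<cdot> \<pi> 1 = d" using A by (simp add: \<iota>_def \<pi>_def)
  ultimately show thesis using that by blast
qed

end


context preadditive_category
begin

text \<open>For a single morphism \<open>f\<close>, the condition on \<open>x\<close> is that \<open>f x\<close> is a monomorphism.\<close>

lemma essential_idempotent_single_iff:
  assumes f: "f \<in> Hom C M N"
  shows "essential_idempotent C M {f} d \<longleftrightarrow> d \<in> Hom C M M \<and> d \<cdot> d = d \<and>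
    (\<forall>a. \<forall>t \<in> Hom C a M. f \<cdot> t = Zero C a N \<longrightarrow> d \<cdot> t = t) \<and>
    (\<forall>a. \<forall>x \<in> Hom C a M. d \<cdot> x = x \<longrightarrow> is_mono C (f \<cdot> x) \<longrightarrow> is_zero_object C a)"
proof -
  have 1: "annihilates C {f} t \<longleftrightarrow> f \<cdot> t = Zero C a N" if "t \<in> Hom C a M" for a t
    using annihilates_single[OF f that] .
  have 2: "(\<forall>b. \<forall>t \<in> Hom C b a. annihilates C {f} (x \<cdot> t) \<longrightarrow> t = Zero C b a)
      \<longleftrightarrow> is_mono C (f \<cdot> x)" if x: "x \<in> Hom C a M" for a x
  proof -
    have "annihilates C {f} (x \<cdot> t) \<longleftrightarrow> (f \<cdot> x) \<cdot> t = Zero C b N" if "t \<in> Hom C b a" for b t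
      using 1[OF Comp_Hom[OF that x]] Comp_assoc[OF that x f] by simp
    then show ?thesis using is_mono_iff[OF Comp_Hom[OF x f]] by simp
  qed
  have 3: "Ident C a = Zero C a a \<longleftrightarrow> is_zero_object C a" if "x \<in> Hom C a M" for a x
    using is_zero_object_iff[OF Hom_Obj(1)[OF that]] by simp
  show ?thesis unfolding essential_idempotent_def by (simp add: 1 2 3 cong: ball_cong)
qed

end

section \<open>The opposite category\<close>

definition opposite :: "('o, 'm, 'x) preadditive_cat_scheme \<Rightarrow> ('o, 'm) preadditive_cat" where
  "opposite C = \<lparr>Obj = Obj C, Arr = Arr C, Dom = Cod C, Cod = Dom C, Ident = Ident C,
    Comp = (\<lambda>g f. f \<cdot>\<^bsub>C\<^esub> g), Plus = Plus C, Zero = (\<lambda>a b. Zero C b a)\<rparr>"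

lemma opposite_simps [simp]:
  "Obj (opposite C) = Obj C" "Arr (opposite C) = Arr C"
  "Dom (opposite C) = Cod C" "Cod (opposite C) = Dom C"
  "Ident (opposite C) = Ident C" "g \<cdot>\<^bsub>opposite C\<^esub> f = f \<cdot>\<^bsub>C\<^esub> g"
  "Plus (opposite C) = Plus C" "Zero (opposite C) a b = Zero C b a"
  by (simp_all add: opposite_def)

lemma Hom_opposite [simp]: "Hom (opposite C) a b = Hom C b a"
  by (auto simp: Hom_def)

lemma Hom_group_opposite [simp]: "Hom_group (opposite C) a b = Hom_group C b a"
  by (simp add: Hom_group_def)

lemma is_mono_opposite [simp]: "is_mono (opposite C) f \<longleftrightarrow> is_epi C f"
  by (simp add: is_mono_def is_epi_def)

lemma is_kernel_opposite [simp]: "is_kernel (opposite C) f q \<longleftrightarrow> is_cokernel C f q"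
  by (simp add: is_kernel_def is_cokernel_def)

lemma is_zero_object_opposite [simp]: "is_zero_object (opposite C) a \<longleftrightarrow> is_zero_object C a"
  by (auto simp: is_zero_object_def)

lemma is_direct_sum_opposite:
  "is_direct_sum C I N S \<iota> \<pi> \<Longrightarrow> is_direct_sum (opposite C) I N S \<pi> \<iota>"
  unfolding is_direct_sum_def by auto

lemma (in preadditive_category) preadditive_category_opposite:
  "preadditive_category (opposite C)"
  by (intro preadditive_category.intro category.intro preadditive_category_axioms.intro)
    (simp_all add: Dom_Obj Cod_Obj Ident_Hom Comp_Hom Comp_Ident Ident_Comp Comp_assoc
      Hom_comm_group Comp_Plus Plus_Comp)

context preadditive_category
begin

lemma is_epi_iff:
  assumes "f \<in> Hom C a b"
  shows "is_epi C f \<longleftrightarrow> (\<forall>c. \<forall>t \<in> Hom C b c. t \<cdot> f = Zero C a c \<longrightarrow> t = Zero C b c)"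
  using preadditive_category.is_mono_iff[OF preadditive_category_opposite, of f b a] assms by simp

lemma is_epi_cancel_Zero:
  "is_epi C f \<Longrightarrow> f \<in> Hom C a b \<Longrightarrow> t \<in> Hom C b c \<Longrightarrow> t \<cdot> f = Zero C a c \<Longrightarrow> t = Zero C b c"
  using is_epi_iff by blast

lemma is_epi_cancel:
  "is_epi C f \<Longrightarrow> f \<in> Hom C a b \<Longrightarrow> t \<in> Hom C b c \<Longrightarrow> s \<in> Hom C b c \<Longrightarrow> t \<cdot> f = s \<cdot> f \<Longrightarrow> t = s"
  using preadditive_category.is_mono_cancel[OF preadditive_category_opposite, of f b a] by simp

lemma is_cokernelD:
  assumes "is_cokernel C f q" "f \<in> Hom C a b"
  shows "q \<in> Hom C b (Cod C q)" "q \<cdot> f = Zero C a (Cod C q)"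
    "\<And>c g. g \<in> Hom C b c \<Longrightarrow> g \<cdot> f = Zero C a c \<Longrightarrow> \<exists>u \<in> Hom C (Cod C q) c. u \<cdot> q = g"
  using preadditive_category.is_kernelD[OF preadditive_category_opposite, of f q b a] assms by simp_all

lemma is_cokernel_imp_is_epi: "is_cokernel C f q \<Longrightarrow> is_epi C q"
  using preadditive_category.is_kernel_imp_is_mono[OF preadditive_category_opposite, of f q] by simp

lemma essential_idempotent_opposite_single_iff:
  assumes "f \<in> Hom C M N"
  shows "essential_idempotent (opposite C) N {f} d \<longleftrightarrow> d \<in> Hom C N N \<and> d \<cdot> d = d \<and>
    (\<forall>b. \<forall>t \<in> Hom C N b. t \<cdot> f = Zero C M b \<longrightarrow> t \<cdot> d = t) \<and>
    (\<forall>b. \<forall>x \<in> Hom C N b. x \<cdot> d = x \<longrightarrow> is_epi C (x \<cdot> f) \<longrightarrow> is_zero_object C b)"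
  using preadditive_category.essential_idempotent_single_iff[OF preadditive_category_opposite, of f N M]
    assms by simp

end

section \<open>Kernels that are essential in a direct summand\<close>

sublocale abelian_category \<subseteq> preadditive_category_with_kernels
  by unfold_locales (rule ex_kernel)

context abelian_category
begin

lemma preadditive_category_with_kernels_opposite:
  "preadditive_category_with_kernels (opposite C)"
  using preadditive_category_opposite ex_cokernel
  by (simp add: preadditive_category_with_kernels_def preadditive_category_with_kernels_axioms_def)

lemma ex_zero_object: "\<exists>z. is_zero_object C z"
proof -
  obtain S and \<iota> \<pi> :: "nat \<Rightarrow> 'm" where "is_direct_sum C {1..0::nat} undefined S \<iota> \<pi>"
    using ex_direct_sum[of 0 undefined] by auto
  then have S: "S \<in> Obj C" "finprod (Hom_group C S S) (\<lambda>i. \<iota> i \<cdot> \<pi> i) {} = Ident C S"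
    unfolding is_direct_sum_def by auto
  interpret G: comm_group "Hom_group C S S" using S by (blast intro: Hom_comm_group)
  have "Ident C S = Zero C S S"
    using S(2) by (simp only: G.finprod_empty) (simp add: Hom_group_def)
  then show ?thesis using is_zero_object_iff S by blast
qed

lemma direct_summandD:
  assumes "direct_summand C M k"
  obtains k' where "k \<in> Hom C (Dom C k) M" "k' \<in> Hom C M (Dom C k)" "k' \<cdot> k = Ident C (Dom C k)"
proof -
  obtain N \<iota> \<pi> where S: "is_direct_sum C {1, 2::nat} N M \<iota> \<pi>" "\<iota> 1 = k"
    using assms unfolding direct_summand_def by blast
  then have "k \<in> Hom C (N 1) M" "\<pi> 1 \<in> Hom C M (N 1)" "\<pi> 1 \<cdot> k = Ident C (N 1)"
    unfolding is_direct_sum_def by auto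
  moreover from this have "Dom C k = N 1" using Hom_Dom_Cod by auto
  ultimately show thesis using that by simp
qed

lemma ex_direct_summand:
  assumes "d \<in> Hom C M M" "d \<cdot> d = d"
  obtains k k' where "direct_summand C M k" "k \<in> Hom C (Dom C k) M" "k' \<in> Hom C M (Dom C k)"
    "k' \<cdot> k = Ident C (Dom C k)" "k \<cdot> k' = d"
proof -
  obtain N \<iota> \<pi> where S: "is_direct_sum C {1, 2::nat} N M \<iota> \<pi>" "\<iota> 1 \<cdot> \<pi> 1 = d"
    using ex_splitting[OF assms] by blast
  then have "\<iota> 1 \<in> Hom C (N 1) M" "\<pi> 1 \<in> Hom C M (N 1)" "\<pi> 1 \<cdot> \<iota> 1 = Ident C (N 1)"
    unfolding is_direct_sum_def by auto
  moreover from this have "Dom C (\<iota> 1) = N 1" using Hom_Dom_Cod by auto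
  moreover have "direct_summand C M (\<iota> 1)" using S unfolding direct_summand_def by blast
  ultimately show thesis using that[of "\<iota> 1" "\<pi> 1"] S by simp
qed

text \<open>The zero subobject is an intersection of \<open>k\<close> and \<open>x\<close>
  exactly if every common lower bound is zero, so essentiality can be tested without intersections.\<close>

lemma essential_iff:
  assumes k: "is_subobject C L k"
  shows "essential C L k \<longleftrightarrow> (\<forall>x. is_subobject C L x \<longrightarrow>
    (\<forall>e. is_subobject C L e \<and> sub_le C e k \<and> sub_le C e x \<longrightarrow> e = Zero C (Dom C e) L)
      \<longrightarrow> is_zero_subobject C L x)"
proof -
  have "(\<exists>d. is_intersection C L k x d \<and> is_zero_subobject C L d) \<longleftrightarrow>
    (\<forall>e. is_subobject C L e \<and> sub_le C e k \<and> sub_le C e x \<longrightarrow> e = Zero C (Dom C e) L)"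
    (is "?l \<longleftrightarrow> ?r") if x: "is_subobject C L x" for x
  proof
    have kH: "k \<in> Hom C (Dom C k) L" and xH: "x \<in> Hom C (Dom C x) L"
      using is_subobjectD(2) k x by blast+
    {
      assume ?l
      then obtain d where d: "is_intersection C L k x d" "is_zero_subobject C L d" by blast
      have dH: "d \<in> Hom C (Dom C d) L" and z: "is_zero_object C (Dom C d)"
        using d is_subobjectD(2) unfolding is_zero_subobject_def by blast+
      show ?r
      proof (intro allI impI)
        fix e assume "is_subobject C L e \<and> sub_le C e k \<and> sub_le C e x"
        then have "sub_le C e d" using d unfolding is_intersection_def by blast
        then obtain h where h: "h \<in> Hom C (Dom C e) (Dom C d)" "e = d \<cdot> h"
          unfolding sub_le_def by blast
        then show "e = Zero C (Dom C e) L"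
          using zero_object_Hom(2)[OF z h(1)] Comp_Zero[OF Hom_Obj(1)[OF h(1)] dH] by metis
      qed
    next
      assume r: ?r
      obtain z where z: "is_zero_object C z" using ex_zero_object by blast
      then have zO: "z \<in> Obj C" unfolding is_zero_object_def by blast
      have L: "L \<in> Obj C" using kH Hom_Obj by blast
      have ZH: "Zero C z b \<in> Hom C z b" "Zero C b z \<in> Hom C b z" if "b \<in> Obj C" for b
        using that zO Zero_Hom by blast+
      have D: "Dom C (Zero C z L) = z" "Cod C (Zero C z L) = L" using ZH[OF L] Hom_Dom_Cod by blast+
      have "is_mono C (Zero C z L)"
        using is_mono_iff[OF ZH(1)[OF L]] zero_object_Hom(2)[OF z] by blast
      then have sub: "is_subobject C L (Zero C z L)" using D unfolding is_subobject_def by blast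
      have le: "sub_le C (Zero C z L) y" if y: "y \<in> Hom C (Dom C y) L" for y
        using Comp_Zero[OF zO y] ZH(1)[OF Hom_Obj(1)[OF y]] D unfolding sub_le_def by metis
      have "sub_le C e (Zero C z L)"
        if e: "is_subobject C L e" "sub_le C e k" "sub_le C e x" for e
      proof -
        have eO: "Dom C e \<in> Obj C" using Hom_Obj is_subobjectD(2)[OF e(1)] by blast
        have "e = Zero C z L \<cdot> Zero C (Dom C e) z"
          using r e Comp_Zero[OF eO ZH(1)[OF L]] by auto
        then show ?thesis using ZH(2)[OF eO] D unfolding sub_le_def by metis
      qed
      then show ?l
        using sub le[OF kH] le[OF xH] z D
        unfolding is_intersection_def is_zero_subobject_def by metis
    }
  qed
  then show ?thesis using k unfolding essential_def by auto
qed

text \<open>A summand \<open>D\<close> with inclusion \<open>\<delta>\<close> and retraction \<open>\<rho>\<close> corresponds to the idempotent \<open>d = \<delta> \<rho>\<close>, and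
  subobjects \<open>y\<close> of \<open>D\<close> correspond to monomorphisms \<open>x = \<delta> y\<close> fixed by \<open>d\<close>.  Under this
  correspondence \<open>y\<close> meets the kernel of \<open>f\<close> in zero exactly if \<open>f x\<close> is a monomorphism.\<close>

lemma essential_in_direct_summand_iff:
  assumes f: "f \<in> Hom C M N" and k: "is_kernel C f k"
  shows "essential_in_direct_summand C M k \<longleftrightarrow> (\<exists>d. essential_idempotent C M {f} d)"
proof
  note kD = is_kernelD[OF k f]
  have k_mono: "is_mono C k" using is_kernel_imp_is_mono[OF k] .
  have o: "M \<in> Obj C" "N \<in> Obj C" using f Hom_Obj by auto
  {
    assume "essential_in_direct_summand C M k"
    then obtain \<delta> k' where \<delta>: "direct_summand C M \<delta>" and k': "k' \<in> Hom C (Dom C k) (Dom C \<delta>)"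
        "k = \<delta> \<cdot> k'" "essential C (Dom C \<delta>) k'"
      unfolding essential_in_direct_summand_def by blast
    let ?D = "Dom C \<delta>"
    obtain \<rho> where \<rho>: "\<delta> \<in> Hom C ?D M" "\<rho> \<in> Hom C M ?D" "\<rho> \<cdot> \<delta> = Ident C ?D"
      using direct_summandD[OF \<delta>] by blast
    have dH: "\<delta> \<cdot> \<rho> \<in> Hom C M M" using \<rho> Comp_Hom by blast
    have fix_\<delta>: "(\<delta> \<cdot> \<rho>) \<cdot> (\<delta> \<cdot> t) = \<delta> \<cdot> t" if t: "t \<in> Hom C a ?D" for a t
      using Comp_assoc[OF Comp_Hom[OF t \<rho>(1)] \<rho>(2,1)] Comp_assoc[OF t \<rho>(1,2)] \<rho>(3)
        Ident_Comp[OF t] by simp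
    have fix_ker: "(\<delta> \<cdot> \<rho>) \<cdot> t = t" if t: "t \<in> Hom C a M" "f \<cdot> t = Zero C a N" for a t
    proof -
      obtain u where u: "u \<in> Hom C a (Dom C k)" "k \<cdot> u = t" using kD(3)[OF t] by blast
      have "t = \<delta> \<cdot> (k' \<cdot> u)" using u k' Comp_assoc[OF u(1) k'(1) \<rho>(1)] by simp
      then show ?thesis using fix_\<delta>[OF Comp_Hom[OF u(1) k'(1)]] by simp
    qed
    have "is_zero_object C a"
      if x: "x \<in> Hom C a M" "(\<delta> \<cdot> \<rho>) \<cdot> x = x" and mono: "is_mono C (f \<cdot> x)" for a x
    proof -
      let ?y = "\<rho> \<cdot> x"
      have yH: "?y \<in> Hom C a ?D" and \<delta>y: "\<delta> \<cdot> ?y = x"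
        using x \<rho> Comp_Hom Comp_assoc[OF x(1) \<rho>(2,1)] by auto
      have fx: "f \<cdot> x \<in> Hom C a N" using Comp_Hom[OF x(1) f] .
      have "t = Zero C c a" if t: "t \<in> Hom C c a" "?y \<cdot> t = Zero C c ?D" for c t
      proof (rule is_mono_cancel_Zero[OF mono fx t(1)])
        have cO: "c \<in> Obj C" using t Hom_Obj by blast
        have "x \<cdot> t = \<delta> \<cdot> (?y \<cdot> t)" using Comp_assoc[OF t(1) yH \<rho>(1)] \<delta>y by simp
        then show "(f \<cdot> x) \<cdot> t = Zero C c N"
          using t Comp_assoc[OF t(1) x(1) f] Comp_Zero[OF cO \<rho>(1)] Comp_Zero[OF cO f] by simp
      qed
      then have y: "is_subobject C ?D ?y"
        using is_mono_iff[OF yH] Hom_Dom_Cod(2)[OF yH] unfolding is_subobject_def by blast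
      have "e = Zero C (Dom C e) ?D"
        if e: "is_subobject C ?D e" "sub_le C e k'" "sub_le C e ?y" for e
      proof -
        let ?E = "Dom C e"
        obtain u where u: "u \<in> Hom C ?E (Dom C k)" "e = k' \<cdot> u"
          using e(2) Hom_Dom_Cod(1)[OF k'(1)] unfolding sub_le_def by auto
        obtain v where v: "v \<in> Hom C ?E a" "e = ?y \<cdot> v"
          using e(3) Hom_Dom_Cod(1)[OF yH] unfolding sub_le_def by auto
        have eO: "?E \<in> Obj C" using u Hom_Obj by blast
        have "x \<cdot> v = \<delta> \<cdot> e" using Comp_assoc[OF v(1) yH \<rho>(1)] \<delta>y v(2) by simp
        also have "\<dots> = k \<cdot> u" using Comp_assoc[OF u(1) k'(1) \<rho>(1)] k'(2) u(2) by simp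
        finally have "(f \<cdot> x) \<cdot> v = (f \<cdot> k) \<cdot> u"
          using Comp_assoc[OF v(1) x(1) f] Comp_assoc[OF u(1) kD(1) f] by simp
        then have "(f \<cdot> x) \<cdot> v = Zero C ?E N" using kD(2) Zero_Comp[OF o(2) u(1)] by simp
        then have "v = Zero C ?E a" using is_mono_cancel_Zero[OF mono fx v(1)] by blast
        then show ?thesis using v(2) Comp_Zero[OF eO yH] by simp
      qed
      then have "is_zero_subobject C ?D ?y"
        using k'(3) y essential_iff[of ?D k'] unfolding essential_def[of C ?D k'] by blast
      then show ?thesis using Hom_Dom_Cod(1)[OF yH] unfolding is_zero_subobject_def by simp
    qed
    then have "essential_idempotent C M {f} (\<delta> \<cdot> \<rho>)"
      unfolding essential_idempotent_single_iff[OF f]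
      using dH fix_\<delta>[OF \<rho>(2)] fix_ker by blast
    then show "\<exists>d. essential_idempotent C M {f} d" by blast
  next
    assume "\<exists>d. essential_idempotent C M {f} d"
    then obtain d where d: "d \<in> Hom C M M" "d \<cdot> d = d"
      and fix_ker: "\<And>a t. t \<in> Hom C a M \<Longrightarrow> f \<cdot> t = Zero C a N \<Longrightarrow> d \<cdot> t = t"
      and zero: "\<And>a x. x \<in> Hom C a M \<Longrightarrow> d \<cdot> x = x \<Longrightarrow> is_mono C (f \<cdot> x) \<Longrightarrow> is_zero_object C a"
      unfolding essential_idempotent_single_iff[OF f] by blast
    obtain \<delta> \<rho> where \<delta>: "direct_summand C M \<delta>" and \<rho>: "\<delta> \<in> Hom C (Dom C \<delta>) M"
        "\<rho> \<in> Hom C M (Dom C \<delta>)" "\<rho> \<cdot> \<delta> = Ident C (Dom C \<delta>)" "\<delta> \<cdot> \<rho> = d"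
      using ex_direct_summand[OF d] by blast
    let ?D = "Dom C \<delta>" and ?k' = "\<rho> \<cdot> k"
    have k': "?k' \<in> Hom C (Dom C k) ?D" "\<delta> \<cdot> ?k' = k"
      using Comp_Hom[OF kD(1) \<rho>(2)] Comp_assoc[OF kD(1) \<rho>(2,1)] \<rho>(4) fix_ker[OF kD(1,2)] by auto
    have "t = Zero C c (Dom C k)" if t: "t \<in> Hom C c (Dom C k)" "?k' \<cdot> t = Zero C c ?D" for c t
    proof (rule is_mono_cancel_Zero[OF k_mono kD(1) t(1)])
      show "k \<cdot> t = Zero C c M"
        using Comp_assoc[OF t(1) k'(1) \<rho>(1)] k'(2) t Comp_Zero[OF Hom_Obj(1)[OF t(1)] \<rho>(1)] by simp
    qed
    then have k'_sub: "is_subobject C ?D ?k'"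
      using is_mono_iff[OF k'(1)] Hom_Dom_Cod(2)[OF k'(1)] unfolding is_subobject_def by blast
    have "is_zero_subobject C ?D y"
      if y: "is_subobject C ?D y"
        and int: "\<forall>e. is_subobject C ?D e \<and> sub_le C e ?k' \<and> sub_le C e y \<longrightarrow>
          e = Zero C (Dom C e) ?D" for y
    proof -
      let ?Y = "Dom C y"
      have y_mono: "is_mono C y" and yH: "y \<in> Hom C ?Y ?D"
        using is_subobjectD[OF y] by blast+
      let ?x = "\<delta> \<cdot> y"
      have xH: "?x \<in> Hom C ?Y M" using Comp_Hom[OF yH \<rho>(1)] .
      have \<rho>x: "\<rho> \<cdot> (\<delta> \<cdot> t) = t" if "t \<in> Hom C b ?D" for b t
        using Comp_assoc[OF that \<rho>(1,2)] \<rho>(3) Ident_Comp[OF that] by simp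
      have dx: "d \<cdot> ?x = ?x" using Comp_assoc[OF xH \<rho>(2,1)] \<rho>x[OF yH] \<rho>(4) by simp
      have fx: "f \<cdot> ?x \<in> Hom C ?Y N" using Comp_Hom[OF xH f] .
      \<comment> \<open>The intersection of \<open>y\<close> with the kernel of \<open>f\<close>, realized as a subobject of the domain of
        \<open>y\<close>: it must be zero, and then \<open>f x\<close> is monic.\<close>
      obtain \<kappa> where \<kappa>: "is_kernel C (f \<cdot> ?x) \<kappa>" using ex_kernel Hom_Dom_Cod(3)[OF fx] by blast
      note \<kappa>D = is_kernelD[OF \<kappa> fx]
      let ?K = "Dom C \<kappa>"
      have \<kappa>_mono: "is_mono C \<kappa>" using is_kernel_imp_is_mono[OF \<kappa>] .
      have yk: "y \<cdot> \<kappa> \<in> Hom C ?K ?D" and KO: "?K \<in> Obj C"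
        using Comp_Hom[OF \<kappa>D(1) yH] Hom_Obj \<kappa>D(1) by auto
      have "t = Zero C c ?K" if t: "t \<in> Hom C c ?K" "(y \<cdot> \<kappa>) \<cdot> t = Zero C c ?D" for c t
        using is_mono_cancel_Zero[OF \<kappa>_mono \<kappa>D(1) t(1)] t Comp_assoc[OF t(1) \<kappa>D(1) yH]
          is_mono_cancel_Zero[OF y_mono yH Comp_Hom[OF t(1) \<kappa>D(1)]] by simp
      then have e: "is_subobject C ?D (y \<cdot> \<kappa>)"
        using is_mono_iff[OF yk] Hom_Dom_Cod(2)[OF yk] unfolding is_subobject_def by blast
      have "f \<cdot> (?x \<cdot> \<kappa>) = Zero C ?K N" using \<kappa>D(2) Comp_assoc[OF \<kappa>D(1) xH f] by simp
      then obtain u where u: "u \<in> Hom C ?K (Dom C k)" "k \<cdot> u = ?x \<cdot> \<kappa>"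
        using kD(3)[OF Comp_Hom[OF \<kappa>D(1) xH]] by blast
      have "?k' \<cdot> u = \<rho> \<cdot> (\<delta> \<cdot> (y \<cdot> \<kappa>))"
        using u Comp_assoc[OF u(1) kD(1) \<rho>(2)] Comp_assoc[OF \<kappa>D(1) yH \<rho>(1)] by simp
      then have "y \<cdot> \<kappa> = ?k' \<cdot> u" using \<rho>x[OF yk] by simp
      then have "sub_le C (y \<cdot> \<kappa>) ?k'" "sub_le C (y \<cdot> \<kappa>) y"
        using u(1) \<kappa>D(1) Hom_Dom_Cod(1)[OF yk] Hom_Dom_Cod(1)[OF k'(1)]
        unfolding sub_le_def by metis+
      then have "y \<cdot> \<kappa> = Zero C ?K ?D" using int e Hom_Dom_Cod(1)[OF yk] by metis
      then have \<kappa>0: "\<kappa> = Zero C ?K ?Y" using is_mono_cancel_Zero[OF y_mono yH \<kappa>D(1)] by blast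
      have "t = Zero C c ?Y" if t: "t \<in> Hom C c ?Y" "(f \<cdot> ?x) \<cdot> t = Zero C c N" for c t
      proof -
        obtain w where w: "w \<in> Hom C c ?K" "\<kappa> \<cdot> w = t" using \<kappa>D(3)[OF t] by blast
        then show ?thesis using \<kappa>0 Zero_Comp[OF Hom_Obj(1)[OF yH] w(1)] by simp
      qed
      then have "is_mono C (f \<cdot> ?x)" using is_mono_iff[OF fx] by blast
      then show ?thesis using zero[OF xH dx] y unfolding is_zero_subobject_def by blast
    qed
    then have "essential C ?D ?k'" using essential_iff[OF k'_sub] by blast
    then show "essential_in_direct_summand C M k"
      using \<delta> k' unfolding essential_in_direct_summand_def by metis
  }
qed

lemma cs_rickart_iff: "cs_rickart C M N \<longleftrightarrow> has_essential_idempotents C M N"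
  unfolding cs_rickart_def has_essential_idempotents_def
  using essential_in_direct_summand_iff ex_kernel Hom_Dom_Cod(3) by metis

section \<open>Images that lie above a direct summand\<close>

text \<open>The step from an epimorphism to the whole object is where the category has to be balanced: \<open>e\<close>
  is the kernel of some \<open>g\<close>, and \<open>g e = 0\<close> with \<open>e\<close> epic gives \<open>g = 0\<close>.\<close>

lemma sub_le_Ident_iff:
  assumes e: "is_subobject C L e"
  shows "sub_le C (Ident C L) e \<longleftrightarrow> is_epi C e"
proof
  note eH = is_subobjectD(2)[OF e]
  have L: "L \<in> Obj C" using eH Hom_Obj by blast
  {
    assume "sub_le C (Ident C L) e"
    then obtain h where h: "h \<in> Hom C L (Dom C e)" "e \<cdot> h = Ident C L"
      using Hom_Dom_Cod(1)[OF Ident_Hom[OF L]] unfolding sub_le_def by auto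
    have "t = Zero C L c" if t: "t \<in> Hom C L c" "t \<cdot> e = Zero C (Dom C e) c" for c t
      using Comp_assoc[OF h(1) eH t(1)] h t Comp_Ident[OF t(1)] Zero_Comp[OF Hom_Obj(2)[OF t(1)] h(1)]
      by simp
    then show "is_epi C e" using is_epi_iff[OF eH] by blast
  next
    assume epi: "is_epi C e"
    obtain g where g: "is_kernel C g e" using mono_is_kernel is_subobjectD(1)[OF e] by blast
    then have gH: "g \<in> Hom C L (Cod C g)"
      using Arr_Hom Hom_Dom_Cod(2)[OF eH] unfolding is_kernel_def by metis
    note D = is_kernelD[OF g gH]
    have "g = Zero C L (Cod C g)" using is_epi_cancel_Zero[OF epi eH gH D(2)] .
    then have "g \<cdot> Ident C L = Zero C L (Cod C g)" using Comp_Ident[OF gH] by simp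
    then obtain h where "h \<in> Hom C L (Dom C e)" "e \<cdot> h = Ident C L"
      using D(3)[OF Ident_Hom[OF L]] by blast
    then show "sub_le C (Ident C L) e"
      using Hom_Dom_Cod(1)[OF Ident_Hom[OF L]] unfolding sub_le_def by metis
  }
qed

text \<open>The subobjects \<open>k\<close> and \<open>x\<close> sum to \<open>L\<close> exactly if they are
  jointly epic: a morphism \<open>c\<close> that kills both kills their sum, because both are contained in the
  kernel of \<open>c\<close>.\<close>

lemma superfluous_iff:
  assumes k: "is_subobject C L k"
  shows "superfluous C L k \<longleftrightarrow> (\<forall>x. is_subobject C L x \<longrightarrow>
    (\<forall>b. \<forall>c \<in> Hom C L b. c \<cdot> k = Zero C (Dom C k) b \<longrightarrow> c \<cdot> x = Zero C (Dom C x) b \<longrightarrow>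
      c = Zero C L b) \<longrightarrow> is_epi C x)"
proof -
  note kH = is_subobjectD(2)[OF k]
  have L: "L \<in> Obj C" using kH Hom_Obj by blast
  note ID = Ident_Hom[OF L]
  have le_Id: "sub_le C x (Ident C L)" if x: "is_subobject C L x" for x
    using is_subobjectD(2)[OF x] Ident_Comp[OF is_subobjectD(2)[OF x]] Hom_Dom_Cod(1)[OF ID]
    unfolding sub_le_def by metis
  have "Ident C L \<cdot> t = t" if "t \<in> Hom C c L" for c t using Ident_Comp[OF that] .
  then have Id_sub: "is_subobject C L (Ident C L)"
    using is_mono_iff[OF ID] Hom_Dom_Cod(2)[OF ID] unfolding is_subobject_def by simp
  have trans: "sub_le C x z" if xyz: "sub_le C x y" "sub_le C y z" "is_subobject C L z" for x y z
  proof -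
    obtain g h where gh: "g \<in> Hom C (Dom C x) (Dom C y)" "x = y \<cdot> g"
        "h \<in> Hom C (Dom C y) (Dom C z)" "y = z \<cdot> h"
      using xyz unfolding sub_le_def by blast
    then have "x = z \<cdot> (h \<cdot> g)" using Comp_assoc[OF gh(1,3) is_subobjectD(2)[OF xyz(3)]] by simp
    then show ?thesis using Comp_Hom[OF gh(1,3)] unfolding sub_le_def by blast
  qed
  have "(\<exists>s. is_sum C L k x s \<and> sub_eq C s (Ident C L)) \<longleftrightarrow>
    (\<forall>b. \<forall>c \<in> Hom C L b. c \<cdot> k = Zero C (Dom C k) b \<longrightarrow> c \<cdot> x = Zero C (Dom C x) b \<longrightarrow>
      c = Zero C L b)" (is "?l \<longleftrightarrow> ?r") if x: "is_subobject C L x" for x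
  proof
    note xH = is_subobjectD(2)[OF x]
    {
      assume ?l
      then have full: "is_epi C e"
        if e: "is_subobject C L e" "sub_le C k e" "sub_le C x e" for e
        using trans e sub_le_Ident_iff[OF e(1)] unfolding is_sum_def sub_eq_def by blast
      show ?r
      proof (intro allI ballI impI)
        fix b c assume c: "c \<in> Hom C L b" "c \<cdot> k = Zero C (Dom C k) b" "c \<cdot> x = Zero C (Dom C x) b"
        obtain e where e: "is_kernel C c e" using ex_kernel Hom_Dom_Cod(3)[OF c(1)] by blast
        note eD = is_kernelD[OF e c(1)]
        have "is_subobject C L e"
          using is_kernel_imp_is_mono[OF e] Hom_Dom_Cod(2)[OF eD(1)] unfolding is_subobject_def by blast
        moreover have "sub_le C k e" "sub_le C x e"
          using eD(3)[OF kH c(2)] eD(3)[OF xH c(3)] unfolding sub_le_def by metis+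
        ultimately show "c = Zero C L b" using full is_epi_cancel_Zero[OF _ eD(1) c(1) eD(2)] by blast
      qed
    next
      assume r: ?r
      have "sub_le C (Ident C L) e"
        if e: "is_subobject C L e" "sub_le C k e" "sub_le C x e" for e
      proof -
        note eH = is_subobjectD(2)[OF e(1)]
        have kill: "c \<cdot> y = Zero C (Dom C y) b"
          if c: "c \<in> Hom C L b" "c \<cdot> e = Zero C (Dom C e) b" and y: "sub_le C y e" for b c y
        proof -
          obtain h where h: "h \<in> Hom C (Dom C y) (Dom C e)" "y = e \<cdot> h"
            using y unfolding sub_le_def by blast
          then show ?thesis
            using Comp_assoc[OF h(1) eH c(1)] c(2) Zero_Comp[OF Hom_Obj(2)[OF c(1)] h(1)] by simp
        qed
        have "is_epi C e" using r kill e(2,3) is_epi_iff[OF eH] by blast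
        then show ?thesis using sub_le_Ident_iff[OF e(1)] by blast
      qed
      then have "is_sum C L k x (Ident C L)"
        using Id_sub le_Id k x unfolding is_sum_def by blast
      moreover have "sub_eq C (Ident C L) (Ident C L)"
        using le_Id[OF Id_sub] unfolding sub_eq_def by blast
      ultimately show ?l by blast
    }
  qed
  moreover have "sub_eq C x (Ident C L) \<longleftrightarrow> is_epi C x" if "is_subobject C L x" for x
    using that le_Id sub_le_Ident_iff unfolding sub_eq_def by blast
  ultimately show ?thesis using k unfolding superfluous_def by simp
qed

text \<open>An epimorphism is a cokernel of its own kernel.\<close>

lemma epi_factor_through_kernel:
  assumes y: "is_epi C y" "y \<in> Hom C a b" and v: "is_kernel C y v"
    and c: "c \<in> Hom C a d" "c \<cdot> v = Zero C (Dom C v) d"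
  obtains w where "w \<in> Hom C b d" "w \<cdot> y = c"
proof -
  note vD = is_kernelD[OF v y(2)]
  obtain g where g: "is_cokernel C g y" using epi_is_cokernel[OF y(1)] by blast
  then have gH: "g \<in> Hom C (Dom C g) a"
    using Arr_Hom Hom_Dom_Cod(1)[OF y(2)] unfolding is_cokernel_def by metis
  note gD = is_cokernelD[OF g gH]
  have b: "Cod C y = b" using Hom_Dom_Cod(2)[OF y(2)] .
  obtain u where u: "u \<in> Hom C (Dom C g) (Dom C v)" "v \<cdot> u = g"
    using vD(3)[OF gH] gD(2) b by auto
  have "c \<cdot> g = Zero C (Dom C g) d"
    using Comp_assoc[OF u(1) vD(1) c(1)] u(2) c(2) Zero_Comp[OF Hom_Obj(2)[OF c(1)] u(1)] by simp
  then show thesis using gD(3)[OF c(1)] b that by blast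
qed

text \<open>Write \<open>L\<close> for the image of \<open>f\<close> and \<open>K\<close> for the summand.  The idempotent \<open>d\<close> is the projection
  along \<open>K\<close>, so a morphism \<open>x\<close> out of \<open>N\<close> satisfies \<open>x d = x\<close> exactly if it factors as \<open>y q\<close> through
  the quotient \<open>q : N \<rightarrow> N/K\<close>.  Such an \<open>x\<close> has \<open>x f\<close> epic exactly if \<open>y\<close> is epic and \<open>L/K\<close> together
  with the kernel of \<open>y\<close> is all of \<open>N/K\<close>.  So superfluity of \<open>L/K\<close> is tested on kernels of
  epimorphisms \<open>y\<close> in one direction, and on the cokernel \<open>c\<close> of a complement candidate \<open>x\<close>, with
  \<open>c q\<close> in the role of the morphism out of \<open>N\<close>, in the other.\<close>

lemma lies_above_direct_summand_iff:
  assumes f: "f \<in> Hom C M N" and m: "is_image C f m"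
  shows "lies_above_direct_summand C N m \<longleftrightarrow>
    (\<exists>d. essential_idempotent (opposite C) N {f} d)"
proof
  have o: "M \<in> Obj C" "N \<in> Obj C" using f Hom_Obj by auto
  obtain r where r: "is_cokernel C f r" "is_kernel C r m" using m unfolding is_image_def by blast
  note rD = is_cokernelD[OF r(1) f]
  note mD = is_kernelD[OF r(2) rD(1)]
  have m_mono: "is_mono C m" using is_kernel_imp_is_mono[OF r(2)] .
  have m_sub: "is_subobject C N m"
    using m_mono Hom_Dom_Cod(2)[OF mD(1)] unfolding is_subobject_def by blast
  let ?L = "Dom C m"
  obtain f' where f': "f' \<in> Hom C M ?L" "m \<cdot> f' = f" using mD(3)[OF f rD(2)] by blast
  \<comment> \<open>A form of the fact that the corestriction of \<open>f\<close> to its image is epic: what kills \<open>f\<close> factors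
    through the cokernel of \<open>f\<close>, of which \<open>m\<close> is the kernel.\<close>
  have kill_m: "t \<cdot> m = Zero C ?L b \<longleftrightarrow> t \<cdot> f = Zero C M b" if t: "t \<in> Hom C N b" for b t
  proof
    assume "t \<cdot> m = Zero C ?L b"
    then show "t \<cdot> f = Zero C M b"
      using Comp_assoc[OF f'(1) mD(1) t] f'(2) Zero_Comp[OF Hom_Obj(2)[OF t] f'(1)] by simp
  next
    assume "t \<cdot> f = Zero C M b"
    then obtain u where u: "u \<in> Hom C (Cod C r) b" "u \<cdot> r = t" using rD(3)[OF t] by blast
    then show "t \<cdot> m = Zero C ?L b"
      using Comp_assoc[OF mD(1) rD(1) u(1)] mD(2) Comp_Zero[OF Hom_Obj(1)[OF mD(1)] u(1)] by simp
  qed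
  {
    assume "lies_above_direct_summand C N m"
    then obtain k h q p j where k: "direct_summand C N k" and h: "h \<in> Hom C (Dom C k) ?L" "k = m \<cdot> h"
      and q: "is_cokernel C k q" and p: "is_cokernel C h p"
      and j: "j \<in> Hom C (Cod C p) (Cod C q)" "j \<cdot> p = q \<cdot> m" "superfluous C (Cod C q) j"
      unfolding lies_above_direct_summand_def by blast
    let ?K = "Dom C k" and ?Q = "Cod C q"
    obtain k' where k': "k \<in> Hom C ?K N" "k' \<in> Hom C N ?K" "k' \<cdot> k = Ident C ?K"
      using direct_summandD[OF k] by blast
    note qD = is_cokernelD[OF q k'(1)]
    note pD = is_cokernelD[OF p h(1)]
    have KO: "?K \<in> Obj C" using k' Hom_Obj by blast
    have kk: "k \<cdot> k' \<in> Hom C N N" using Comp_Hom[OF k'(2,1)] .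
    have kkk: "(k \<cdot> k') \<cdot> k = k" using Comp_assoc[OF k'(1,2,1)] k'(3) Comp_Ident[OF k'(1)] by simp
    have kk_idem: "(k \<cdot> k') \<cdot> (k \<cdot> k') = k \<cdot> k'" using Comp_assoc[OF k'(2,1) kk] kkk by simp
    obtain d where d: "d \<in> Hom C N N" "d \<cdot> d = d"
      and d_fix: "\<And>b t. t \<in> Hom C N b \<Longrightarrow> t \<cdot> d = t \<longleftrightarrow> t \<cdot> (k \<cdot> k') = Zero C N b"
      by (rule ex_complement[OF kk kk_idem]) (rule that; assumption)
    have d_fix: "t \<cdot> d = t \<longleftrightarrow> t \<cdot> k = Zero C ?K b" if t: "t \<in> Hom C N b" for b t
    proof -
      have bO: "b \<in> Obj C" using t Hom_Obj by blast
      have "t \<cdot> k = (t \<cdot> (k \<cdot> k')) \<cdot> k" using Comp_assoc[OF k'(1) kk t] kkk by simp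
      then have "t \<cdot> (k \<cdot> k') = Zero C N b \<Longrightarrow> t \<cdot> k = Zero C ?K b"
        using Zero_Comp[OF bO k'(1)] by simp
      moreover have "t \<cdot> k = Zero C ?K b \<Longrightarrow> t \<cdot> (k \<cdot> k') = Zero C N b"
        using Comp_assoc[OF k'(2,1) t] Zero_Comp[OF bO k'(2)] by simp
      ultimately show ?thesis using d_fix[OF t] by blast
    qed
    have coker: "t \<cdot> d = t" if t: "t \<in> Hom C N b" "t \<cdot> f = Zero C M b" for b t
    proof -
      have "t \<cdot> m = Zero C ?L b" using kill_m[OF t(1)] t(2) by blast
      then have "t \<cdot> k = Zero C ?K b"
        using Comp_assoc[OF h(1) mD(1) t(1)] h(2) Zero_Comp[OF Hom_Obj(2)[OF t(1)] h(1)] by simp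
      then show ?thesis using d_fix[OF t(1)] by blast
    qed
    have "is_zero_object C b"
      if x: "x \<in> Hom C N b" "x \<cdot> d = x" and epi: "is_epi C (x \<cdot> f)" for b x
    proof -
      have bO: "b \<in> Obj C" using x Hom_Obj by blast
      have "x \<cdot> k = Zero C ?K b" using d_fix[OF x(1)] x(2) by blast
      then obtain y where y: "y \<in> Hom C ?Q b" "y \<cdot> q = x" using qD(3)[OF x(1)] by blast
      have xf: "x \<cdot> f \<in> Hom C M b" using Comp_Hom[OF f x(1)] .
      have kill_x: "t = Zero C b c" if t: "t \<in> Hom C b c" "(t \<cdot> x) \<cdot> f = Zero C M c" for c t
        using is_epi_cancel_Zero[OF epi xf t(1)] Comp_assoc[OF f x(1) t(1)] t(2) by simp
      have kill_y: "t = Zero C b c" if t: "t \<in> Hom C b c" "t \<cdot> y = Zero C ?Q c" for c t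
      proof (rule kill_x[OF t(1)])
        have cO: "c \<in> Obj C" using t Hom_Obj by blast
        show "(t \<cdot> x) \<cdot> f = Zero C M c"
          using Comp_assoc[OF qD(1) y(1) t(1)] y(2) t(2) Zero_Comp[OF cO qD(1)] Zero_Comp[OF cO f]
          by simp
      qed
      have y_epi: "is_epi C y" using is_epi_iff[OF y(1)] kill_y by blast
      obtain v where v: "is_kernel C y v" using ex_kernel Hom_Dom_Cod(3)[OF y(1)] by blast
      note vD = is_kernelD[OF v y(1)]
      have v_sub: "is_subobject C ?Q v"
        using is_kernel_imp_is_mono[OF v] Hom_Dom_Cod(2)[OF vD(1)] unfolding is_subobject_def by blast
      have "c = Zero C ?Q a"
        if c: "c \<in> Hom C ?Q a" "c \<cdot> j = Zero C (Dom C j) a" "c \<cdot> v = Zero C (Dom C v) a" for a c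
      proof -
        have aO: "a \<in> Obj C" using c Hom_Obj by blast
        obtain w where w: "w \<in> Hom C b a" "w \<cdot> y = c"
          using epi_factor_through_kernel[OF y_epi y(1) v c(1,3)] by blast
        have cq: "c \<cdot> q \<in> Hom C N a" using Comp_Hom[OF qD(1) c(1)] .
        have "(c \<cdot> q) \<cdot> m = (c \<cdot> j) \<cdot> p"
          using Comp_assoc[OF mD(1) qD(1) c(1)] Comp_assoc[OF pD(1) j(1) c(1)] j(2) by simp
        then have "(c \<cdot> q) \<cdot> m = Zero C ?L a"
          using c(2) Hom_Dom_Cod(1)[OF j(1)] Zero_Comp[OF aO pD(1)] by simp
        then have "(c \<cdot> q) \<cdot> f = Zero C M a" using kill_m[OF cq] by blast
        moreover have "c \<cdot> q = w \<cdot> x" using Comp_assoc[OF qD(1) y(1) w(1)] y(2) w(2) by simp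
        ultimately have "w = Zero C b a" using kill_x[OF w(1)] by simp
        then show ?thesis using w(2) Zero_Comp[OF aO y(1)] by simp
      qed
      then have "is_epi C v"
        using j(3) v_sub superfluous_iff[of ?Q j] unfolding superfluous_def[of C ?Q j] by blast
      then have "y = Zero C ?Q b" using is_epi_cancel_Zero[OF _ vD(1) y(1) vD(2)] by blast
      then have "Ident C b = Zero C b b" using kill_y[OF Ident_Hom[OF bO]] Ident_Comp[OF y(1)] by simp
      then show ?thesis using is_zero_object_iff[OF bO] by blast
    qed
    then have "essential_idempotent (opposite C) N {f} d"
      unfolding essential_idempotent_opposite_single_iff[OF f] using d coker by blast
    then show "\<exists>d. essential_idempotent (opposite C) N {f} d" by blast
  next
    assume "\<exists>d. essential_idempotent (opposite C) N {f} d"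
    then obtain d where d: "d \<in> Hom C N N" "d \<cdot> d = d"
      and coker: "\<And>b t. t \<in> Hom C N b \<Longrightarrow> t \<cdot> f = Zero C M b \<Longrightarrow> t \<cdot> d = t"
      and zero: "\<And>b x. x \<in> Hom C N b \<Longrightarrow> x \<cdot> d = x \<Longrightarrow> is_epi C (x \<cdot> f) \<Longrightarrow> is_zero_object C b"
      unfolding essential_idempotent_opposite_single_iff[OF f] by blast
    obtain d' where d': "d' \<in> Hom C N N" "d' \<cdot> d' = d'"
      and left: "\<And>a t. t \<in> Hom C a N \<Longrightarrow> d' \<cdot> t = t \<longleftrightarrow> d \<cdot> t = Zero C a N"
      and right: "\<And>b t. t \<in> Hom C N b \<Longrightarrow> t \<cdot> d = t \<longleftrightarrow> t \<cdot> d' = Zero C N b"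
      by (rule ex_complement[OF d]) (rule that; assumption)
    obtain k k' where k: "direct_summand C N k" and k': "k \<in> Hom C (Dom C k) N"
        "k' \<in> Hom C N (Dom C k)" "k' \<cdot> k = Ident C (Dom C k)" "k \<cdot> k' = d'"
      using ex_direct_summand[OF d'] by blast
    let ?K = "Dom C k"
    have KO: "?K \<in> Obj C" using k' Hom_Obj by blast
    have d'k: "d' \<cdot> k = k" using Comp_assoc[OF k'(1,2,1)] k'(3,4) Comp_Ident[OF k'(1)] by simp
    have kill_k: "t \<cdot> k = Zero C ?K b \<longleftrightarrow> t \<cdot> d = t" if t: "t \<in> Hom C N b" for b t
      using right[OF t] Comp_assoc[OF k'(1) d'(1) t] d'k Comp_assoc[OF k'(2,1) t] k'(4)
        Zero_Comp[OF Hom_Obj(2)[OF t] k'(1)] Zero_Comp[OF Hom_Obj(2)[OF t] k'(2)] by metis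
    have "r \<cdot> k = Zero C ?K (Cod C r)" using kill_k[OF rD(1)] coker[OF rD(1,2)] by blast
    then obtain h where h: "h \<in> Hom C ?K ?L" "m \<cdot> h = k" using mD(3)[OF k'(1)] by blast
    obtain q where q: "is_cokernel C k q" using ex_cokernel Hom_Dom_Cod(3)[OF k'(1)] by blast
    obtain p where p: "is_cokernel C h p" using ex_cokernel Hom_Dom_Cod(3)[OF h(1)] by blast
    note qD = is_cokernelD[OF q k'(1)]
    note pD = is_cokernelD[OF p h(1)]
    have p_epi: "is_epi C p" using is_cokernel_imp_is_epi[OF p] .
    let ?Q = "Cod C q" and ?P = "Cod C p"
    have qm: "q \<cdot> m \<in> Hom C ?L ?Q" using Comp_Hom[OF mD(1) qD(1)] .
    have "(q \<cdot> m) \<cdot> h = Zero C ?K ?Q" using Comp_assoc[OF h(1) mD(1) qD(1)] h(2) qD(2) by simp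
    then obtain j where j: "j \<in> Hom C ?P ?Q" "j \<cdot> p = q \<cdot> m" using pD(3)[OF qm] by blast
    \<comment> \<open>The induced morphism \<open>j : L/K \<rightarrow> N/K\<close> is monic: the retraction \<open>k'\<close> of \<open>K\<close> restricts to a
      retraction \<open>k' m\<close> on \<open>L\<close>, so \<open>p\<close> has a section \<open>s\<close>, and if \<open>j t = 0\<close> then \<open>s t\<close> lands in \<open>K\<close>.\<close>
    have "t = Zero C c ?P" if t: "t \<in> Hom C c ?P" "j \<cdot> t = Zero C c ?Q" for c t
    proof -
      have cO: "c \<in> Obj C" using t Hom_Obj by blast
      let ?l = "k' \<cdot> m"
      have lH: "?l \<in> Hom C ?L ?K" using Comp_Hom[OF mD(1) k'(2)] .
      have lh: "?l \<cdot> h = Ident C ?K" using Comp_assoc[OF h(1) mD(1) k'(2)] h(2) k'(3) by simp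
      have hl: "h \<cdot> ?l \<in> Hom C ?L ?L" using Comp_Hom[OF lH h(1)] .
      have hlh: "(h \<cdot> ?l) \<cdot> h = h" using Comp_assoc[OF h(1) lH h(1)] lh Comp_Ident[OF h(1)] by simp
      have hl_idem: "(h \<cdot> ?l) \<cdot> (h \<cdot> ?l) = h \<cdot> ?l" using Comp_assoc[OF lH h(1) hl] hlh by simp
      obtain g where g: "g \<in> Hom C ?L ?L"
        and g_left: "\<And>a t. t \<in> Hom C a ?L \<Longrightarrow> (h \<cdot> ?l) \<cdot> t = t \<longleftrightarrow> g \<cdot> t = Zero C a ?L"
        and g_right: "\<And>b t. t \<in> Hom C ?L b \<Longrightarrow> t \<cdot> g = t \<longleftrightarrow> t \<cdot> (h \<cdot> ?l) = Zero C ?L b"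
        by (rule ex_complement[OF hl hl_idem]) (rule that; assumption)
      have "g \<cdot> h = Zero C ?K ?L" using g_left[OF h(1)] hlh by blast
      then obtain s where s: "s \<in> Hom C ?P ?L" "s \<cdot> p = g" using pD(3)[OF g] by blast
      have "p \<cdot> (h \<cdot> ?l) = Zero C ?L ?P"
        using Comp_assoc[OF lH h(1) pD(1)] pD(2) Zero_Comp[OF Hom_Obj(2)[OF pD(1)] lH] by simp
      then have "p \<cdot> g = p" using g_right[OF pD(1)] by blast
      then have "(p \<cdot> s) \<cdot> p = Ident C ?P \<cdot> p"
        using Comp_assoc[OF pD(1) s(1) pD(1)] s(2) Ident_Comp[OF pD(1)] by simp
      then have ps: "p \<cdot> s = Ident C ?P"
        using is_epi_cancel[OF p_epi pD(1) Comp_Hom[OF s(1) pD(1)] Ident_Hom[OF Hom_Obj(2)[OF pD(1)]]]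
        by blast
      have st: "s \<cdot> t \<in> Hom C c ?L" using Comp_Hom[OF t(1) s(1)] .
      have pst: "p \<cdot> (s \<cdot> t) = t" using Comp_assoc[OF t(1) s(1) pD(1)] ps Ident_Comp[OF t(1)] by simp
      have mst: "m \<cdot> (s \<cdot> t) \<in> Hom C c N" using Comp_Hom[OF st mD(1)] .
      have qmst: "q \<cdot> (m \<cdot> (s \<cdot> t)) = Zero C c ?Q"
        using Comp_assoc[OF st mD(1) qD(1)] Comp_assoc[OF st pD(1) j(1)] j(2) pst t(2) by simp
      have "d \<cdot> k = Zero C ?K N" using left[OF k'(1)] d'k by blast
      then obtain w where w: "w \<in> Hom C ?Q N" "w \<cdot> q = d" using qD(3)[OF d(1)] by blast
      have "d \<cdot> (m \<cdot> (s \<cdot> t)) = Zero C c N"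
        using Comp_assoc[OF mst qD(1) w(1)] w(2) qmst Comp_Zero[OF cO w(1)] by simp
      then have fixed: "d' \<cdot> (m \<cdot> (s \<cdot> t)) = m \<cdot> (s \<cdot> t)" using left[OF mst] by blast
      have lst: "?l \<cdot> (s \<cdot> t) \<in> Hom C c ?K" using Comp_Hom[OF st lH] .
      have "m \<cdot> (h \<cdot> (?l \<cdot> (s \<cdot> t))) = k \<cdot> (k' \<cdot> (m \<cdot> (s \<cdot> t)))"
        using Comp_assoc[OF lst h(1) mD(1)] h(2) Comp_assoc[OF st mD(1) k'(2)] by simp
      also have "\<dots> = m \<cdot> (s \<cdot> t)" using Comp_assoc[OF mst k'(2,1)] k'(4) fixed by simp
      finally have "h \<cdot> (?l \<cdot> (s \<cdot> t)) = s \<cdot> t"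
        using is_mono_cancel[OF m_mono mD(1) Comp_Hom[OF lst h(1)] st] by blast
      then have "t = (p \<cdot> h) \<cdot> (?l \<cdot> (s \<cdot> t))" using Comp_assoc[OF lst h(1) pD(1)] pst by simp
      then show ?thesis using pD(2) Zero_Comp[OF Hom_Obj(2)[OF pD(1)] lst] by simp
    qed
    then have j_sub: "is_subobject C ?Q j"
      using is_mono_iff[OF j(1)] Hom_Dom_Cod(2)[OF j(1)] unfolding is_subobject_def by blast
    have "is_epi C x"
      if x: "is_subobject C ?Q x"
        and joint: "\<forall>b. \<forall>c \<in> Hom C ?Q b. c \<cdot> j = Zero C (Dom C j) b \<longrightarrow>
          c \<cdot> x = Zero C (Dom C x) b \<longrightarrow> c = Zero C ?Q b" for x
    proof -
      note xH = is_subobjectD(2)[OF x]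
      obtain c where c: "is_cokernel C x c" using ex_cokernel Hom_Dom_Cod(3)[OF xH] by blast
      note cD = is_cokernelD[OF c xH]
      let ?R = "Cod C c"
      have cq: "c \<cdot> q \<in> Hom C N ?R" using Comp_Hom[OF qD(1) cD(1)] .
      have "q \<cdot> d = q" using kill_k[OF qD(1)] qD(2) by blast
      then have fixed: "(c \<cdot> q) \<cdot> d = c \<cdot> q" using Comp_assoc[OF d(1) qD(1) cD(1)] by simp
      have "t = Zero C ?R b" if t: "t \<in> Hom C ?R b" "t \<cdot> ((c \<cdot> q) \<cdot> f) = Zero C M b" for b t
      proof -
        have bO: "b \<in> Obj C" using t Hom_Obj by blast
        have tc: "t \<cdot> c \<in> Hom C ?Q b" and tcq: "t \<cdot> (c \<cdot> q) \<in> Hom C N b"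
          using Comp_Hom[OF cD(1) t(1)] Comp_Hom[OF cq t(1)] by blast+
        have "(t \<cdot> (c \<cdot> q)) \<cdot> m = Zero C ?L b"
          using kill_m[OF tcq] Comp_assoc[OF f cq t(1)] t(2) by simp
        moreover have "((t \<cdot> c) \<cdot> j) \<cdot> p = (t \<cdot> (c \<cdot> q)) \<cdot> m"
          using Comp_assoc[OF pD(1) j(1) tc] j(2) Comp_assoc[OF mD(1) qD(1) tc]
            Comp_assoc[OF qD(1) cD(1) t(1)] by simp
        ultimately have "(t \<cdot> c) \<cdot> j = Zero C ?P b"
          using is_epi_cancel_Zero[OF p_epi pD(1) Comp_Hom[OF j(1) tc]] by simp
        moreover have "(t \<cdot> c) \<cdot> x = Zero C (Dom C x) b"
          using Comp_assoc[OF xH cD(1) t(1)] cD(2) Comp_Zero[OF Hom_Obj(1)[OF xH] t(1)] by simp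
        ultimately have "t \<cdot> c = Zero C ?Q b" using joint tc Hom_Dom_Cod(1)[OF j(1)] by auto
        then show ?thesis
          using is_epi_cancel_Zero[OF is_cokernel_imp_is_epi[OF c] cD(1) t(1)] by blast
      qed
      then have "is_epi C ((c \<cdot> q) \<cdot> f)" using is_epi_iff[OF Comp_Hom[OF f cq]] by blast
      then have z: "is_zero_object C ?R" using zero[OF cq fixed] by blast
      have "t = Zero C ?Q b" if t: "t \<in> Hom C ?Q b" "t \<cdot> x = Zero C (Dom C x) b" for b t
      proof -
        obtain w where w: "w \<in> Hom C ?R b" "w \<cdot> c = t" using cD(3)[OF t] by blast
        then show ?thesis
          using zero_object_Hom(1)[OF z w(1)] Zero_Comp[OF Hom_Obj(2)[OF t(1)] cD(1)] by simp
      qed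
      then show ?thesis using is_epi_iff[OF xH] by blast
    qed
    then have "superfluous C ?Q j" using superfluous_iff[OF j_sub] by blast
    then show "lies_above_direct_summand C N m"
      using m_sub k h q p j unfolding lies_above_direct_summand_def by metis
  }
qed

text \<open>Source and target change places in the opposite category: the summand now belongs to \<open>N\<close>.\<close>

lemma dual_cs_rickart_iff:
  "dual_cs_rickart C M N \<longleftrightarrow> has_essential_idempotents (opposite C) N M"
proof -
  have "\<exists>m. is_image C f m" if "f \<in> Hom C M N" for f
    using ex_cokernel[OF Hom_Dom_Cod(3)[OF that]] ex_kernel
    unfolding is_image_def is_cokernel_def by metis
  then show ?thesis
    unfolding dual_cs_rickart_def has_essential_idempotents_def Hom_opposite
    using lies_above_direct_summand_iff by metis
qed

end

section \<open>CS-Rickart properties of finite direct sums\<close>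

theorem theorem4p2:
  fixes C :: "('o, 'm, 'x) preadditive_cat_scheme"
  assumes "abelian_category C"
  shows
    "(\<forall>M \<in> Obj C. \<forall>(n::nat) N S \<iota> \<pi>.
        (\<forall>i\<in>{1..n}. N i \<in> Obj C) \<longrightarrow> is_direct_sum C {1..n} N S \<iota> \<pi> \<longrightarrow>
        (cs_rickart C M S \<longleftrightarrow> (\<forall>i\<in>{1..n}. cs_rickart C M (N i)))) \<and>
     (\<forall>N \<in> Obj C. \<forall>(n::nat) M S \<iota> \<pi>.
        (\<forall>i\<in>{1..n}. M i \<in> Obj C) \<longrightarrow> is_direct_sum C {1..n} M S \<iota> \<pi> \<longrightarrow>
        (dual_cs_rickart C S N \<longleftrightarrow> (\<forall>i\<in>{1..n}. dual_cs_rickart C (M i) N)))"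
proof -
  interpret abelian_category C by fact
  interpret op: preadditive_category_with_kernels "opposite C"
    by (rule preadditive_category_with_kernels_opposite)
  show ?thesis
    unfolding cs_rickart_iff dual_cs_rickart_iff
    using has_essential_idempotents_direct_sum
      op.has_essential_idempotents_direct_sum[OF is_direct_sum_opposite]
    by (metis opposite_simps(1))
qed

end
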